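(* Let $(g_t)_{t\in I}$ be a super Ricci flow on a compact manifold $M$, let $[t_0,t_1]\subset I$ and let $u\in C^\infty(M\times[t_0,t_1])$ be a solution to the heat equation $\partial_t u=\triangle_{g_t}u$. Let $T\ge0$. Suppose that $u$ only takes values in $(0,1)$ and, if $T>0$, suppose that $|\nabla(\Phi_T^{-1}(u(\cdot,t_0)))|\le1$ (gradient norm with respect to $g_{t_0}$). Then $$\big|\nabla\big(\Phi^{-1}_{T+t-t_0}(u(\cdot,t))\big)\big|\le 1$$ (gradient norm with respect to $g_t$) for all $t\in[t_0,t_1]$ with $T+t-t_0>0$.
   Context: A super Ricci flow is a smooth family of Riemannian metrics $(g_t)_{t\in I}$, $I\subset\mathbb R$ an interval, with $\partial_t g_t+2\operatorname{Ric}_{g_t}\ge0$. Let $\Phi:\mathbb R\to(0,1)$ be the function with $\Phi'(x)=(4\pi)^{-1/2}e^{-x^2/4}$, $\lim_{x\to-\infty}\Phi(x)=0$ and $\lim_{x\to\infty}\Phi(x)=1$. For $t>0$ set $\Phi_t(x)=\Phi(t^{-1/2}x)$, and let $\Phi_t^{-1}:(0,1)\to\mathbb R$ be the inverse function of $\Phi_t:\mathbb R\to(0,1)$. *)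

theory Defs
  imports "HOL-Probability.Probability"
begin

section \<open>Smooth functions on subsets of Euclidean space\<close>

text \<open>\<open>Ck_on k f S\<close> is meant for open \<open>S\<close>.\<close>

primrec Ck_on ::
  "nat \<Rightarrow> ('a::euclidean_space \<Rightarrow> 'b::real_normed_vector) \<Rightarrow> 'a set \<Rightarrow> bool" where
  "Ck_on 0 f S \<longleftrightarrow> continuous_on S f"
| "Ck_on (Suc k) f S \<longleftrightarrow>
     (\<forall>x\<in>S. f differentiable (at x)) \<and>
     (\<forall>b\<in>Basis. Ck_on k (\<lambda>x. frechet_derivative f (at x) b) S)"

text \<open>
  For a set \<open>S\<close> that is not open (here: a product of an open set with an interval that may contain
  its endpoints), smoothness means that \<open>f\<close> extends smoothly to a neighbourhood of each point.
\<close>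

definition smooth_on ::
  "'a::euclidean_space set \<Rightarrow> ('a \<Rightarrow> 'b::real_normed_vector) \<Rightarrow> bool" where
  "smooth_on S f \<longleftrightarrow>
     (\<forall>x\<in>S. \<exists>U F. open U \<and> x \<in> U \<and> (\<forall>k. Ck_on k F U) \<and> (\<forall>y\<in>S \<inter> U. F y = f y))"

definition pderiv_at :: "'n::finite \<Rightarrow> (real^'n \<Rightarrow> real) \<Rightarrow> real^'n \<Rightarrow> real" where
  "pderiv_at i f x = frechet_derivative f (at x) (axis i 1)"


section \<open>Riemannian geometry in one coordinate system\<close>

text \<open>In this section \<open>G x\<close> is the matrix \<open>(g\<^sub>i\<^sub>j(x))\<close> of a metric.\<close>

text \<open>\<open>christoffel G x k i j\<close> is $\Gamma^k_{ij}$.\<close>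

definition christoffel :: "(real^'n \<Rightarrow> real^'n^'n) \<Rightarrow> real^'n \<Rightarrow> 'n::finite \<Rightarrow> 'n \<Rightarrow> 'n \<Rightarrow> real" where
  "christoffel G x k i j =
     (1/2) * (\<Sum>l\<in>UNIV. matrix_inv (G x) $ k $ l *
        (pderiv_at i (\<lambda>y. G y $ j $ l) x + pderiv_at j (\<lambda>y. G y $ i $ l) x
          - pderiv_at l (\<lambda>y. G y $ i $ j) x))"

text \<open>
  \<open>riemann G x l i j k\<close> is the \<open>l\<close>-th component of
  $R(\partial_i,\partial_j)\partial_k
    = \nabla_i \nabla_j \partial_k - \nabla_j \nabla_i \partial_k$,
  and \<open>ricci G x $ j $ k\<close> is the trace of $X \mapsto R(X,\partial_j)\partial_k$; with these signs
  the Ricci curvature of round spheres is positive.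
\<close>

definition riemann ::
  "(real^'n \<Rightarrow> real^'n^'n) \<Rightarrow> real^'n \<Rightarrow> 'n::finite \<Rightarrow> 'n \<Rightarrow> 'n \<Rightarrow> 'n \<Rightarrow> real" where
  "riemann G x l i j k =
     pderiv_at i (\<lambda>y. christoffel G y l j k) x - pderiv_at j (\<lambda>y. christoffel G y l i k) x
     + (\<Sum>m\<in>UNIV. christoffel G x m j k * christoffel G x l i m
                 - christoffel G x m i k * christoffel G x l j m)"

definition ricci :: "(real^'n::finite \<Rightarrow> real^'n^'n) \<Rightarrow> real^'n \<Rightarrow> real^'n^'n" where
  "ricci G x = (\<chi> j k. \<Sum>i\<in>UNIV. riemann G x i i j k)"

definition hessian :: "(real^'n::finite \<Rightarrow> real^'n^'n) \<Rightarrow> (real^'n \<Rightarrow> real) \<Rightarrow> real^'n \<Rightarrow> real^'n^'n" where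
  "hessian G f x = (\<chi> i j. pderiv_at i (pderiv_at j f) x
                        - (\<Sum>k\<in>UNIV. christoffel G x k i j * pderiv_at k f x))"

definition laplacian :: "(real^'n::finite \<Rightarrow> real^'n^'n) \<Rightarrow> (real^'n \<Rightarrow> real) \<Rightarrow> real^'n \<Rightarrow> real" where
  "laplacian G f x = (\<Sum>i\<in>UNIV. \<Sum>j\<in>UNIV. matrix_inv (G x) $ i $ j * hessian G f x $ i $ j)"

definition gradient :: "(real^'n::finite \<Rightarrow> real^'n^'n) \<Rightarrow> (real^'n \<Rightarrow> real) \<Rightarrow> real^'n \<Rightarrow> real^'n" where
  "gradient G f x = matrix_inv (G x) *v (\<chi> i. pderiv_at i f x)"

definition metric_norm :: "real^'n^'n \<Rightarrow> real^'n::finite \<Rightarrow> real" where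
  "metric_norm h v = sqrt (v \<bullet> (h *v v))"


section \<open>Compact manifolds and Riemannian metrics\<close>

text \<open>A chart is a coordinate domain together with its coordinate map.\<close>

type_synonym ('a, 'n) chart = "'a set \<times> ('a \<Rightarrow> real^'n)"

abbreviation chart_dom :: "('a, 'n::finite) chart \<Rightarrow> 'a set" where
  "chart_dom c \<equiv> fst c"

abbreviation chart_map :: "('a, 'n::finite) chart \<Rightarrow> 'a \<Rightarrow> real^'n" where
  "chart_map c \<equiv> snd c"

definition chart_inv :: "('a, 'n::finite) chart \<Rightarrow> real^'n \<Rightarrow> 'a" where
  "chart_inv c = inv_into (chart_dom c) (chart_map c)"

definition is_chart :: "'a::topological_space set \<Rightarrow> ('a, 'n::finite) chart \<Rightarrow> bool" where
  "is_chart M c \<longleftrightarrow>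
     openin (top_of_set M) (chart_dom c) \<and> open (chart_map c ` chart_dom c) \<and>
     homeomorphism (chart_dom c) (chart_map c ` chart_dom c) (chart_map c) (chart_inv c)"

definition transition :: "('a, 'n::finite) chart \<Rightarrow> ('a, 'n) chart \<Rightarrow> real^'n \<Rightarrow> real^'n" where
  "transition c d = chart_map d \<circ> chart_inv c"

definition smooth_atlas :: "'a::topological_space set \<Rightarrow> ('a, 'n::finite) chart set \<Rightarrow> bool" where
  "smooth_atlas M A \<longleftrightarrow>
     (\<forall>c\<in>A. is_chart M c) \<and> M = (\<Union>c\<in>A. chart_dom c) \<and>
     (\<forall>c\<in>A. \<forall>d\<in>A. smooth_on (chart_map c ` (chart_dom c \<inter> chart_dom d)) (transition c d))"

text \<open>
  Boundaryless, not necessarily connected, with the topology induced from the ambient Hausdorff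
  type. Second countability follows from compactness.
\<close>

definition compact_manifold :: "'a::t2_space set \<Rightarrow> ('a, 'n::finite) chart set \<Rightarrow> bool" where
  "compact_manifold M A \<longleftrightarrow> compact M \<and> smooth_atlas M A"

text \<open>
  A symmetric 2-tensor field \<open>h\<close> is represented by its component matrices \<open>h c p\<close> in the charts
  \<open>c\<close> around \<open>p\<close>.
\<close>

type_synonym ('a, 'n) tensor2 = "('a, 'n) chart \<Rightarrow> 'a \<Rightarrow> real^'n^'n"

definition in_chart :: "('a, 'n::finite) chart \<Rightarrow> ('a \<Rightarrow> 'b) \<Rightarrow> real^'n \<Rightarrow> 'b" where
  "in_chart c f = f \<circ> chart_inv c"

definition jacobian :: "('a, 'n::finite) chart \<Rightarrow> ('a, 'n) chart \<Rightarrow> 'a \<Rightarrow> real^'n^'n" where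
  "jacobian c d p = matrix (frechet_derivative (transition c d) (at (chart_map c p)))"

definition riemannian_metric :: "('a, 'n::finite) chart set \<Rightarrow> ('a, 'n) tensor2 \<Rightarrow> bool" where
  "riemannian_metric A h \<longleftrightarrow>
     (\<forall>c\<in>A. smooth_on (chart_map c ` chart_dom c) (in_chart c (h c))) \<and>
     (\<forall>c\<in>A. \<forall>p\<in>chart_dom c.
        transpose (h c p) = h c p \<and> (\<forall>v. v \<noteq> 0 \<longrightarrow> v \<bullet> (h c p *v v) > 0)) \<and>
     (\<forall>c\<in>A. \<forall>d\<in>A. \<forall>p\<in>chart_dom c \<inter> chart_dom d.
        h c p = transpose (jacobian c d p) ** h d p ** jacobian c d p)"

text \<open>
  The following quantities are computed in a chart \<open>c\<close> around \<open>p\<close>; the scalars do not depend on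
  its choice.
\<close>

definition ricci_in ::
  "('a, 'n::finite) chart \<Rightarrow> ('a, 'n) tensor2 \<Rightarrow> 'a \<Rightarrow> real^'n^'n" where
  "ricci_in c h p = ricci (in_chart c (h c)) (chart_map c p)"

definition laplacian_in ::
  "('a, 'n::finite) chart \<Rightarrow> ('a, 'n) tensor2 \<Rightarrow> ('a \<Rightarrow> real) \<Rightarrow> 'a \<Rightarrow> real" where
  "laplacian_in c h f p = laplacian (in_chart c (h c)) (in_chart c f) (chart_map c p)"

definition grad_norm_in ::
  "('a, 'n::finite) chart \<Rightarrow> ('a, 'n) tensor2 \<Rightarrow> ('a \<Rightarrow> real) \<Rightarrow> 'a \<Rightarrow> real" where
  "grad_norm_in c h f p =
     metric_norm (h c p) (gradient (in_chart c (h c)) (in_chart c f) (chart_map c p))"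


section \<open>Super Ricci flows and the heat equation\<close>

text \<open>
  Time derivatives are taken within the time interval, so they are one-sided at its endpoints.
\<close>

definition smooth_family ::
  "('a, 'n::finite) chart set \<Rightarrow> real set \<Rightarrow> (real \<Rightarrow> ('a, 'n) tensor2) \<Rightarrow> bool" where
  "smooth_family A I g \<longleftrightarrow>
     (\<forall>c\<in>A. smooth_on (I \<times> chart_map c ` chart_dom c) (\<lambda>(t, x). g t c (chart_inv c x)))"

definition super_ricci_flow ::
  "('a, 'n::finite) chart set \<Rightarrow> real set \<Rightarrow> (real \<Rightarrow> ('a, 'n) tensor2) \<Rightarrow> bool" where
  "super_ricci_flow A I g \<longleftrightarrow>
     is_interval I \<and> (\<forall>t\<in>I. riemannian_metric A (g t)) \<and> smooth_family A I g \<and>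
     (\<forall>t\<in>I. \<forall>c\<in>A. \<forall>p\<in>chart_dom c. \<exists>D.
        ((\<lambda>s. g s c p) has_vector_derivative D) (at t within I) \<and>
        (\<forall>v. v \<bullet> ((D + 2 *\<^sub>R ricci_in c (g t) p) *v v) \<ge> 0))"

definition smooth_on_spacetime ::
  "('a, 'n::finite) chart set \<Rightarrow> real set \<Rightarrow> ('a \<Rightarrow> real \<Rightarrow> real) \<Rightarrow> bool" where
  "smooth_on_spacetime A J u \<longleftrightarrow>
     (\<forall>c\<in>A. smooth_on (chart_map c ` chart_dom c \<times> J) (\<lambda>(x, t). u (chart_inv c x) t))"

definition heat_solution ::
  "('a, 'n::finite) chart set \<Rightarrow> real set \<Rightarrow> (real \<Rightarrow> ('a, 'n) tensor2) \<Rightarrow>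
    ('a \<Rightarrow> real \<Rightarrow> real) \<Rightarrow> bool" where
  "heat_solution A J g u \<longleftrightarrow>
     smooth_on_spacetime A J u \<and>
     (\<forall>t\<in>J. \<forall>c\<in>A. \<forall>p\<in>chart_dom c.
        ((\<lambda>s. u p s) has_real_derivative laplacian_in c (g t) (\<lambda>q. u q t) p) (at t within J))"


section \<open>The functions \<open>\<Phi>\<close> and \<open>\<Phi>\<^sub>t\<close>\<close>

definition Phi :: "real \<Rightarrow> real" where
  "Phi = (THE f.
     (\<forall>x. (f has_real_derivative (4 * pi) powr (-1/2) * exp (- x\<^sup>2 / 4)) (at x)) \<and>
     (f \<longlongrightarrow> 0) at_bot \<and> (f \<longlongrightarrow> 1) at_top)"

lemma Phi_ex1:
  "\<exists>!f :: real \<Rightarrow> real.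
     (\<forall>x. (f has_real_derivative (4 * pi) powr (-1/2) * exp (- x\<^sup>2 / 4)) (at x)) \<and>
     (f \<longlongrightarrow> 0) at_bot \<and> (f \<longlongrightarrow> 1) at_top"
proof (rule ex_ex1I)
  define d where "d = normal_density 0 (sqrt 2)"
  define N where "N = density lborel d"
  have d: "d x = (4 * pi) powr (-1/2) * exp (- x\<^sup>2 / 4)" for x
    by (simp add: d_def normal_density_def powr_minus powr_half_sqrt divide_simps)
  have cont: "continuous_on S d" for S
    unfolding d normal_density_def[abs_def] d_def by (intro continuous_intros) auto
  interpret N: prob_space N
    unfolding N_def d_def by (rule prob_space_normal_density) simp
  interpret N: real_distribution N
    by unfold_locales (simp_all add: N_def)
  have diff: "cdf N b - cdf N a = integral {a..b} d" if "a < b" for a b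
  proof -
    have int: "set_integrable lborel {a<..b} d"
      unfolding set_integrable_def d_def
      by (intro integrable_mult_indicator integrable_normal_density) auto
    have "cdf N b - cdf N a = measure N {a<..b}"
      using that by (rule N.cdf_diff_eq)
    also have "\<dots> = (LINT x:{a<..b}|lborel. d x)"
    proof -
      have "emeasure N {a<..b} = (\<integral>\<^sup>+x. ennreal (indicator {a<..b} x * d x) \<partial>lborel)"
        unfolding N_def d_def
        by (subst emeasure_density)
           (auto intro!: nn_integral_cong split: split_indicator)
      also have "\<dots> = ennreal (LINT x|lborel. indicator {a<..b} x * d x)"
        using int by (intro nn_integral_eq_integral) (auto simp: set_integrable_def d_def)
      finally show ?thesis
        by (simp add: measure_def set_lebesgue_integral_def d_def integral_nonneg)
    qed
    also have "\<dots> = integral {a<..b} d"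
      by (rule set_borel_integral_eq_integral(2)[OF int])
    also have "\<dots> = integral {a..b} d"
    proof (rule integral_subset_negligible)
      have "{a..b} - {a<..b} = {a}"
        using that by auto
      then show "negligible ({a..b} - {a<..b})"
        by simp
    qed auto
    finally show ?thesis .
  qed
  have "(cdf N has_real_derivative d x) (at x)" for x
  proof -
    have "((\<lambda>y. integral {x - 1..y} d) has_real_derivative d x) (at x within {x - 1..x + 1})"
      by (rule integral_has_real_derivative) (auto intro: cont)
    then have "((\<lambda>y. cdf N (x - 1) + integral {x - 1..y} d) has_real_derivative d x)
        (at x within {x - 1<..<x + 1})"
      by (auto intro!: derivative_eq_intros intro: has_field_derivative_subset)
    then have "((\<lambda>y. cdf N (x - 1) + integral {x - 1..y} d) has_real_derivative d x) (at x)"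
      by (subst (asm) at_within_open) auto
    then show ?thesis
    proof (rule has_field_derivative_transform_within_open)
      show "cdf N (x - 1) + integral {x - 1..y} d = cdf N y" if "y \<in> {x - 1<..}" for y
        using diff[of "x - 1" y] that by simp
    qed auto
  qed
  then show "\<exists>f :: real \<Rightarrow> real.
     (\<forall>x. (f has_real_derivative (4 * pi) powr (-1/2) * exp (- x\<^sup>2 / 4)) (at x)) \<and>
     (f \<longlongrightarrow> 0) at_bot \<and> (f \<longlongrightarrow> 1) at_top"
    unfolding d using N.cdf_lim_at_bot N.cdf_lim_at_top_prob by blast
next
  fix f h :: "real \<Rightarrow> real"
  assume f: "(\<forall>x. (f has_real_derivative (4 * pi) powr (-1/2) * exp (- x\<^sup>2 / 4)) (at x)) \<and>
     (f \<longlongrightarrow> 0) at_bot \<and> (f \<longlongrightarrow> 1) at_top"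
    and h: "(\<forall>x. (h has_real_derivative (4 * pi) powr (-1/2) * exp (- x\<^sup>2 / 4)) (at x)) \<and>
     (h \<longlongrightarrow> 0) at_bot \<and> (h \<longlongrightarrow> 1) at_top"
  have "((\<lambda>x. f x - h x) has_real_derivative 0) (at x)" for x
    using DERIV_diff[OF f[THEN conjunct1, rule_format, of x] h[THEN conjunct1, rule_format, of x]]
    by simp
  then have "f x - h x = f 0 - h 0" for x
    using DERIV_isconst_all[of "\<lambda>x. f x - h x" x 0] by blast
  then have const: "(\<lambda>x. f x - h x) = (\<lambda>x. f 0 - h 0)"
    by blast
  have "((\<lambda>x. f x - h x) \<longlongrightarrow> 0 - 0) at_bot"
    using f h by (intro tendsto_diff) auto
  then have "((\<lambda>x::real. f 0 - h 0) \<longlongrightarrow> 0) at_bot"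
    unfolding const by simp
  then have "f 0 - h 0 = 0"
    by (simp add: tendsto_const_iff)
  then show "f = h"
    using fun_cong[OF const] by (intro ext) (metis eq_iff_diff_eq_0)
qed

lemma
  shows Phi_has_derivative:
      "(Phi has_real_derivative (4 * pi) powr (-1/2) * exp (- x\<^sup>2 / 4)) (at x)"
    and Phi_at_bot: "(Phi \<longlongrightarrow> 0) at_bot"
    and Phi_at_top: "(Phi \<longlongrightarrow> 1) at_top"
  using theI'[OF Phi_ex1] unfolding Phi_def[symmetric] by blast+

definition Phi_scaled :: "real \<Rightarrow> real \<Rightarrow> real" where
  "Phi_scaled t x = Phi (t powr (-1/2) * x)"

text \<open>Only used for \<open>t > 0\<close> and arguments in \<open>(0, 1)\<close>.\<close>

definition Phi_inv :: "real \<Rightarrow> real \<Rightarrow> real" where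
  "Phi_inv t = inv (Phi_scaled t)"

end

(*
  Let psi be the square of the profile phi o Phi^{-1}, where phi = Phi'. Since
  |nabla Phi_tau^{-1}(u)|^2 = tau |nabla u|^2 / psi(u), the claim says tau |nabla u|^2 <= psi(u)
  for tau = T + t - t_0. In this form the case T = 0 is not singular: the bound is trivial at
  tau = 0. For kappa > 1 put R = tau |nabla u|^2 - kappa psi(u), which is negative at time t_0.
  At a first zero of R the gradient of R vanishes, so nabla u is an eigenvector of the Hessian of u
  with eigenvalue lambda = kappa psi'(u) / (2 tau). There Bochner's formula, the super Ricci flow
  inequality, |Hess u|^2 >= lambda^2 and psi'^2 = 2 psi (psi'' + 1) give
  0 <= (d/dt - Laplace) R <= (1 - kappa) |nabla u|^2 < 0. Finally kappa tends to 1.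
*)
theory Submission
  imports Defs
begin

section \<open>Functions of class $C^k$\<close>

text \<open>The first zero of R is sought on all of M x [t_0, t_1], while the contradiction is a
  pointwise computation in coordinates. Hence |nabla u|^2 is shown to be independent of the chart
  and jointly continuous, so that compactness yields a first time; the computation then takes place
  on one coordinate ball at that time. Only earlier times are controlled there, and the zero may sit
  at t_1, so the time derivative of R is one-sided, and the derivatives of u in time come from local
  smooth extensions past the ends of the interval.

  The factor kappa supplies both strict inequalities: R < 0 at t_0, as psi > 0, and the final sign.
  In (d/dt - Laplace) R the term |nabla u|^2 comes from d tau/dt = 1 and kappa psi'' |nabla u|^2
  from the Laplacian of psi(u). At the zero, where tau |nabla u|^2 = kappa psi, the identity for
  psi'^2 turns 2 tau lambda^2 into kappa (psi'' + 1) |nabla u|^2, so psi'' cancels. Positivity of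
  psi also makes nabla u nonzero there, as an eigenvector has to be.\<close>

lemma Ck_on_cong:
  assumes "open S" "\<And>x. x \<in> S \<Longrightarrow> f x = g x" "Ck_on k f S"
  shows "Ck_on k g S"
  using assms(2,3)
proof (induction k arbitrary: f g)
  case 0
  then show ?case by (metis Ck_on.simps(1) continuous_on_cong)
next
  case (Suc k)
  have d: "f differentiable (at x)" if "x \<in> S" for x
    using Suc.prems(2) that by simp
  have "g differentiable (at x)" if "x \<in> S" for x
    using d[OF that] Suc.prems(1) assms(1) that unfolding differentiable_def
    by (meson has_derivative_transform_within_open)
  moreover have "Ck_on k (\<lambda>x. frechet_derivative g (at x) b) S" if "b \<in> Basis" for b
  proof (rule Suc.IH)
    show "Ck_on k (\<lambda>x. frechet_derivative f (at x) b) S"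
      using Suc.prems(2) that by simp
    show "frechet_derivative f (at x) b = frechet_derivative g (at x) b" if "x \<in> S" for x
      using frechet_derivative_transform_within_open[OF d[OF that] assms(1) that Suc.prems(1)]
      by metis
  qed
  ultimately show ?case by simp
qed

text \<open>Introduction rule for the closure properties below: any explicit formula for the
  derivative, as produced by the sum, product or chain rule, may stand in for
  \<open>frechet_derivative\<close>.\<close>

lemma Ck_on_SucI:
  assumes S: "open S"
    and f: "\<And>x. x \<in> S \<Longrightarrow> (f has_derivative f' x) (at x)"
    and "\<And>b. b \<in> Basis \<Longrightarrow> Ck_on k (\<lambda>x. f' x b) S"
  shows "Ck_on (Suc k) f S"
proof -
  have "Ck_on k (\<lambda>x. frechet_derivative f (at x) b) S" if "b \<in> Basis" for b
    by (rule Ck_on_cong[OF S _ assms(3)[OF that]]) (metis f frechet_derivative_at)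
  moreover have "f differentiable (at x)" if "x \<in> S" for x
    using f[OF that] by (auto simp: differentiable_def)
  ultimately show ?thesis by simp
qed

lemma Ck_on_Suc_imp_continuous_on:
  "Ck_on (Suc k) f S \<Longrightarrow> continuous_on S f"
  by (intro continuous_at_imp_continuous_on ballI differentiable_imp_continuous_within) simp

lemma Ck_on_Suc_imp_Ck_on: "Ck_on (Suc k) f S \<Longrightarrow> Ck_on k f S"
proof (induction k arbitrary: f)
  case 0
  then have "continuous_on S f" by (rule Ck_on_Suc_imp_continuous_on)
  then show ?case by (simp only: Ck_on.simps(1))
next
  case (Suc k)
  then show ?case by simp
qed

lemma Ck_on_subset: "Ck_on k f S \<Longrightarrow> T \<subseteq> S \<Longrightarrow> Ck_on k f T"
  by (induction k arbitrary: f) (auto intro: continuous_on_subset)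

lemma Ck_on_const: "Ck_on k (\<lambda>x. c) S"
  by (induction k arbitrary: c) auto

lemma Ck_on_has_derivative:
  assumes "Ck_on (Suc k) f S" "x \<in> S"
  shows "(f has_derivative frechet_derivative f (at x)) (at x)"
  using assms frechet_derivative_works by auto

lemma Ck_on_add:
  assumes S: "open S" and "Ck_on k f S" "Ck_on k g S"
  shows "Ck_on k (\<lambda>x. f x + g x) S"
  using assms(2,3)
proof (induction k arbitrary: f g)
  case 0
  then show ?case by (auto intro: continuous_intros)
next
  case (Suc k)
  show ?case
  proof (rule Ck_on_SucI[OF S])
    show "((\<lambda>x. f x + g x) has_derivative
        (\<lambda>b. frechet_derivative f (at x) b + frechet_derivative g (at x) b)) (at x)"
      if "x \<in> S" for x
      using Suc.prems that by (intro has_derivative_add Ck_on_has_derivative)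
  qed (use Suc in auto)
qed

lemma Ck_on_bounded_linear:
  assumes S: "open S" and L: "bounded_linear L" and "Ck_on k f S"
  shows "Ck_on k (\<lambda>x. L (f x)) S"
  using assms(3)
proof (induction k arbitrary: f)
  case 0
  then show ?case using L by (simp add: bounded_linear.continuous_on)
next
  case (Suc k)
  show ?case
  proof (rule Ck_on_SucI[OF S])
    show "((\<lambda>x. L (f x)) has_derivative (\<lambda>b. L (frechet_derivative f (at x) b))) (at x)"
      if "x \<in> S" for x
      using Suc.prems that by (intro bounded_linear.has_derivative[OF L] Ck_on_has_derivative)
  qed (use Suc in auto)
qed

lemma Ck_on_mult:
  fixes f g :: "'a::euclidean_space \<Rightarrow> real"
  assumes S: "open S" and "Ck_on k f S" "Ck_on k g S"
  shows "Ck_on k (\<lambda>x. f x * g x) S"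
  using assms(2,3)
proof (induction k arbitrary: f g)
  case 0
  then show ?case by (auto intro: continuous_intros)
next
  case (Suc k)
  show ?case
  proof (rule Ck_on_SucI[OF S])
    show "((\<lambda>x. f x * g x) has_derivative
        (\<lambda>b. f x * frechet_derivative g (at x) b + frechet_derivative f (at x) b * g x)) (at x)"
      if "x \<in> S" for x
      using Suc.prems that by (intro has_derivative_mult Ck_on_has_derivative)
    show "Ck_on k (\<lambda>x. f x * frechet_derivative g (at x) b + frechet_derivative f (at x) b * g x) S"
      if "b \<in> Basis" for b
      using Suc.prems that Ck_on_Suc_imp_Ck_on[OF Suc.prems(1)] Ck_on_Suc_imp_Ck_on[OF Suc.prems(2)]
      by (intro Ck_on_add[OF S] Suc.IH) auto
  qed
qed

text \<open>The derivative of 1/f contains 1/f again, but only to order k, where the induction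
  hypothesis covers it.\<close>

lemma Ck_on_inverse:
  fixes f :: "'a::euclidean_space \<Rightarrow> real"
  assumes S: "open S" and nz: "\<And>x. x \<in> S \<Longrightarrow> f x \<noteq> 0" and "Ck_on k f S"
  shows "Ck_on k (\<lambda>x. inverse (f x)) S"
  using assms(3)
proof (induction k)
  case 0
  then show ?case using nz by (auto intro: continuous_intros)
next
  case (Suc k)
  show ?case
  proof (rule Ck_on_SucI[OF S])
    show "((\<lambda>x. inverse (f x)) has_derivative
        (\<lambda>b. - (inverse (f x) * frechet_derivative f (at x) b * inverse (f x)))) (at x)"
      if "x \<in> S" for x
      using Suc.prems that nz by (intro Deriv.has_derivative_inverse Ck_on_has_derivative)
    show "Ck_on k (\<lambda>x. - (inverse (f x) * frechet_derivative f (at x) b * inverse (f x))) S"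
      if "b \<in> Basis" for b
      using Suc.prems that Suc.IH[OF Ck_on_Suc_imp_Ck_on[OF Suc.prems]]
      by (intro Ck_on_bounded_linear[OF S bounded_linear_minus[OF bounded_linear_ident]]
          Ck_on_mult[OF S]) auto
  qed
qed

text \<open>Meant for slice inclusions such as x to (x, t). Since the constant derivative
  \<open>L\<close> sends basis vectors to basis vectors, each partial derivative of the composition
  is a single partial derivative of f composed with h, and the induction closes.\<close>

lemma Ck_on_compose_affine:
  assumes S: "open S" and cont: "continuous_on UNIV h"
    and h: "\<And>x. (h has_derivative L) (at x)" and L: "\<And>b. b \<in> Basis \<Longrightarrow> L b \<in> Basis"
    and "Ck_on k f S"
  shows "Ck_on k (\<lambda>x. f (h x)) (h -` S)"
  using assms(5)
proof (induction k arbitrary: f)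
  case 0
  have "continuous_on (h -` S) h" using cont continuous_on_subset by blast
  then show ?case using 0 by (auto intro: continuous_on_compose2)
next
  case (Suc k)
  have o: "open (h -` S)" using S cont by (simp add: open_vimage)
  show ?case
  proof (rule Ck_on_SucI[OF o])
    show "((\<lambda>x. f (h x)) has_derivative (\<lambda>b. frechet_derivative f (at (h x)) (L b))) (at x)"
      if "x \<in> h -` S" for x
      using Suc.prems that h by (intro has_derivative_compose[of h L x UNIV f] Ck_on_has_derivative) auto
    show "Ck_on k (\<lambda>x. frechet_derivative f (at (h x)) (L b)) (h -` S)" if "b \<in> Basis" for b
      using Suc.prems L[OF that] by (intro Suc.IH) auto
  qed
qed

text \<open>All orders at once, so that taking a partial derivative stays inside the class.
  \<open>smooth_on\<close> leads to this notion after passing to a local extension.\<close>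

definition Cinf_on :: "('a::euclidean_space \<Rightarrow> 'b::real_normed_vector) \<Rightarrow> 'a set \<Rightarrow> bool" where
  "Cinf_on f S \<longleftrightarrow> (\<forall>k. Ck_on k f S)"

lemma Cinf_on_const: "Cinf_on (\<lambda>x. c) S"
  by (simp add: Cinf_on_def Ck_on_const)

lemma Cinf_on_add: "open S \<Longrightarrow> Cinf_on f S \<Longrightarrow> Cinf_on g S \<Longrightarrow> Cinf_on (\<lambda>x. f x + g x) S"
  by (simp add: Cinf_on_def Ck_on_add)

lemma Cinf_on_bounded_linear:
  "open S \<Longrightarrow> bounded_linear L \<Longrightarrow> Cinf_on f S \<Longrightarrow> Cinf_on (\<lambda>x. L (f x)) S"
  by (simp add: Cinf_on_def Ck_on_bounded_linear)

lemma Cinf_on_mult: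
  fixes f g :: "'a::euclidean_space \<Rightarrow> real"
  shows "open S \<Longrightarrow> Cinf_on f S \<Longrightarrow> Cinf_on g S \<Longrightarrow> Cinf_on (\<lambda>x. f x * g x) S"
  by (simp add: Cinf_on_def Ck_on_mult)

lemma Cinf_on_diff:
  fixes f g :: "'a::euclidean_space \<Rightarrow> real"
  assumes "open S" "Cinf_on f S" "Cinf_on g S"
  shows "Cinf_on (\<lambda>x. f x - g x) S"
  using Cinf_on_add[OF assms(1,2) Cinf_on_mult[OF assms(1) Cinf_on_const[of "-1"] assms(3)]]
  by simp

lemma Cinf_on_divide:
  fixes f g :: "'a::euclidean_space \<Rightarrow> real"
  assumes "open S" "Cinf_on f S" "Cinf_on g S" "\<And>x. x \<in> S \<Longrightarrow> g x \<noteq> 0"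
  shows "Cinf_on (\<lambda>x. f x / g x) S"
  using assms by (simp add: Cinf_on_def Ck_on_mult Ck_on_inverse divide_inverse)

lemma Cinf_on_sum:
  assumes "open S" "\<And>i. i \<in> J \<Longrightarrow> Cinf_on (f i) S"
  shows "Cinf_on (\<lambda>x. \<Sum>i\<in>J. f i x) S"
  using assms(2)
  by (induction J rule: infinite_finite_induct)
    (auto intro!: Cinf_on_const Cinf_on_add[OF assms(1)])

lemma Cinf_on_prod:
  fixes f :: "'i \<Rightarrow> 'a::euclidean_space \<Rightarrow> real"
  assumes "open S" "\<And>i. i \<in> J \<Longrightarrow> Cinf_on (f i) S"
  shows "Cinf_on (\<lambda>x. \<Prod>i\<in>J. f i x) S"
  using assms(2)
  by (induction J rule: infinite_finite_induct)
    (auto intro!: Cinf_on_const Cinf_on_mult[OF assms(1)])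

lemma Cinf_on_subset: "Cinf_on f S \<Longrightarrow> T \<subseteq> S \<Longrightarrow> Cinf_on f T"
  unfolding Cinf_on_def using Ck_on_subset by blast

lemma Cinf_on_cong: "open S \<Longrightarrow> (\<And>x. x \<in> S \<Longrightarrow> f x = g x) \<Longrightarrow> Cinf_on f S \<Longrightarrow> Cinf_on g S"
  unfolding Cinf_on_def using Ck_on_cong by blast

lemma Cinf_on_differentiable: "Cinf_on f S \<Longrightarrow> x \<in> S \<Longrightarrow> f differentiable (at x)"
  unfolding Cinf_on_def by (metis Ck_on.simps(2))

lemma Cinf_on_continuous_on: "Cinf_on f S \<Longrightarrow> continuous_on S f"
  unfolding Cinf_on_def by (metis Ck_on.simps(1))

lemma Cinf_on_frechet_derivative:
  "Cinf_on f S \<Longrightarrow> b \<in> Basis \<Longrightarrow> Cinf_on (\<lambda>x. frechet_derivative f (at x) b) S"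
  unfolding Cinf_on_def by (metis Ck_on.simps(2))

lemma Cinf_on_Pair_right:
  assumes "open S" "Cinf_on f S"
  shows "Cinf_on (\<lambda>x. f (x, t)) {x. (x, t) \<in> S}"
proof -
  have 1: "Ck_on k (\<lambda>x. f (x, t)) ((\<lambda>x. (x, t)) -` S)" for k
    using assms(2) unfolding Cinf_on_def
    by (intro Ck_on_compose_affine[OF assms(1), where L="\<lambda>h. (h, 0)"])
      (auto intro!: continuous_intros derivative_eq_intros simp: Basis_prod_def)
  show ?thesis using 1 unfolding Cinf_on_def vimage_def by blast
qed

lemma Cinf_on_Pair_left:
  assumes "open S" "Cinf_on f S"
  shows "Cinf_on (\<lambda>x. f (t, x)) {x. (t, x) \<in> S}"
proof -
  have 1: "Ck_on k (\<lambda>x. f (t, x)) ((\<lambda>x. (t, x)) -` S)" for k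
    using assms(2) unfolding Cinf_on_def
    by (intro Ck_on_compose_affine[OF assms(1), where L="\<lambda>h. (0, h)"])
      (auto intro!: continuous_intros derivative_eq_intros simp: Basis_prod_def)
  show ?thesis using 1 unfolding Cinf_on_def vimage_def by blast
qed

text \<open>
  Both mixed derivatives are limits of the same second difference quotient, by the mean value
  theorem applied twice.
\<close>

lemma second_difference_mvt:
  fixes f :: "'a::euclidean_space \<Rightarrow> real"
  assumes f: "\<And>y. y \<in> S \<Longrightarrow> (f has_derivative f' y) (at y)"
    and f'': "\<And>y. y \<in> S \<Longrightarrow> ((\<lambda>y. f' y a) has_derivative f'' y) (at y)"
    and S: "\<And>s t. 0 \<le> s \<Longrightarrow> s \<le> h \<Longrightarrow> 0 \<le> t \<Longrightarrow> t \<le> h \<Longrightarrow> x + s *\<^sub>R a + t *\<^sub>R b \<in> S"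
    and h: "0 < h"
  shows "\<exists>s t. 0 < s \<and> s < h \<and> 0 < t \<and> t < h \<and>
    f (x + h *\<^sub>R a + h *\<^sub>R b) - f (x + h *\<^sub>R a) - f (x + h *\<^sub>R b) + f x
      = h\<^sup>2 * f'' (x + s *\<^sub>R a + t *\<^sub>R b) b"
proof -
  define p where "p s = f (x + s *\<^sub>R a + h *\<^sub>R b) - f (x + s *\<^sub>R a + 0 *\<^sub>R b)" for s
  have dp: "(p has_real_derivative
      (f' (x + s *\<^sub>R a + h *\<^sub>R b) a - f' (x + s *\<^sub>R a + 0 *\<^sub>R b) a)) (at s)"
    if "0 \<le> s" "s \<le> h" for s
  proof -
    have "((\<lambda>s. f (x + s *\<^sub>R a + t *\<^sub>R b)) has_real_derivative f' (x + s *\<^sub>R a + t *\<^sub>R b) a) (at s)"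
      if "0 \<le> t" "t \<le> h" for t
    proof -
      define c where "c = (\<lambda>s. x + s *\<^sub>R a + t *\<^sub>R b)"
      have D: "(f has_derivative f' (c s)) (at (c s))"
        unfolding c_def by (rule f) (use that \<open>0 \<le> s\<close> \<open>s \<le> h\<close> S in auto)
      have "(c has_derivative (\<lambda>z. z *\<^sub>R a)) (at s)"
        unfolding c_def by (auto intro!: derivative_eq_intros)
      from diff_chain_at[OF this D]
      have "((\<lambda>s. f (c s)) has_derivative (\<lambda>z. f' (c s) (z *\<^sub>R a))) (at s)"
        by (simp add: o_def)
      then show ?thesis
        using linear_cmul[OF has_derivative_linear[OF D], of _ a]
        by (simp add: has_field_derivative_def mult_commute_abs c_def)
    qed
    from this[of h] this[of 0] show ?thesis unfolding p_def using h by (intro DERIV_diff) simp_all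
  qed
  obtain s where s: "0 < s" "s < h" and ps: "p h - p 0 = (h - 0) *
      (f' (x + s *\<^sub>R a + h *\<^sub>R b) a - f' (x + s *\<^sub>R a + 0 *\<^sub>R b) a)"
    using MVT2[OF h, of p "\<lambda>s. f' (x + s *\<^sub>R a + h *\<^sub>R b) a - f' (x + s *\<^sub>R a + 0 *\<^sub>R b) a", OF dp]
    by metis
  define q where "q t = f' (x + s *\<^sub>R a + t *\<^sub>R b) a" for t
  have dq: "(q has_real_derivative f'' (x + s *\<^sub>R a + t *\<^sub>R b) b) (at t)"
    if "0 \<le> t" "t \<le> h" for t
  proof -
    define c where "c = (\<lambda>t. x + s *\<^sub>R a + t *\<^sub>R b)"
    have D: "((\<lambda>y. f' y a) has_derivative f'' (c t)) (at (c t))"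
      unfolding c_def by (rule f'') (use that s S in auto)
    have "(c has_derivative (\<lambda>z. z *\<^sub>R b)) (at t)"
      unfolding c_def by (auto intro!: derivative_eq_intros)
    from diff_chain_at[OF this D]
    have "(q has_derivative (\<lambda>z. f'' (c t) (z *\<^sub>R b))) (at t)"
      by (simp add: o_def q_def[abs_def] c_def)
    then show ?thesis
      using linear_cmul[OF has_derivative_linear[OF D], of _ b]
      by (simp add: has_field_derivative_def mult_commute_abs c_def)
  qed
  obtain t where t: "0 < t" "t < h" "q h - q 0 = (h - 0) * f'' (x + s *\<^sub>R a + t *\<^sub>R b) b"
    using MVT2[OF h, of q "\<lambda>t. f'' (x + s *\<^sub>R a + t *\<^sub>R b) b", OF dq] by metis
  have "f (x + h *\<^sub>R a + h *\<^sub>R b) - f (x + h *\<^sub>R a) - f (x + h *\<^sub>R b) + f x = p h - p 0"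
    by (simp add: p_def)
  also have "\<dots> = h * (q h - q 0)" using ps by (simp add: q_def)
  also have "\<dots> = h\<^sup>2 * f'' (x + s *\<^sub>R a + t *\<^sub>R b) b"
    using t(3) by (simp add: power2_eq_square)
  finally show ?thesis using s t(1,2) by blast
qed

lemma frechet_derivative_commute:
  fixes f :: "'a::euclidean_space \<Rightarrow> real"
  assumes S: "open S" "x \<in> S" and f: "Cinf_on f S" and ab: "a \<in> Basis" "b \<in> Basis"
  shows "frechet_derivative (\<lambda>y. frechet_derivative f (at y) a) (at x) b
    = frechet_derivative (\<lambda>y. frechet_derivative f (at y) b) (at x) a"
proof (rule ccontr)
  define P where "P a b y = frechet_derivative (\<lambda>y. frechet_derivative f (at y) a) (at y) b" for a b y
  assume "\<not> ?thesis"
  then have ne: "P a b x \<noteq> P b a x" by (simp add: P_def)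
  \<comment> \<open>Half the gap between the two mixed derivatives: no number lies within
    \<open>e\<close> of both.\<close>
  define e where "e = dist (P a b x) (P b a x) / 2"
  have e: "e > 0" using ne by (simp add: e_def)
  have cont: "continuous (at x) (P c d)" if "c \<in> Basis" "d \<in> Basis" for c d
    unfolding P_def using S that f
    by (metis Cinf_on_frechet_derivative Cinf_on_differentiable differentiable_imp_continuous_within)
  obtain r1 where r1: "r1 > 0" "\<And>y. dist y x < r1 \<Longrightarrow> dist (P a b y) (P a b x) < e"
    using cont[OF ab] e unfolding continuous_at_eps_delta by (auto simp: dist_norm)
  obtain r2 where r2: "r2 > 0" "\<And>y. dist y x < r2 \<Longrightarrow> dist (P b a y) (P b a x) < e"
    using cont[OF ab(2,1)] e unfolding continuous_at_eps_delta by (auto simp: dist_norm)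
  obtain r3 where r3: "r3 > 0" "\<And>y. dist y x < r3 \<Longrightarrow> y \<in> S"
    using S open_dist by blast
  \<comment> \<open>Two displacements of length at most h add up to at most 2h, hence the divisor
    3.\<close>
  define h where "h = min r1 (min r2 r3) / 3"
  have h: "h > 0" using r1 r2 r3 by (simp add: h_def)
  have near: "dist (x + s *\<^sub>R c + t *\<^sub>R d) x < min r1 (min r2 r3)"
    if "0 \<le> s" "s \<le> h" "0 \<le> t" "t \<le> h" "c \<in> Basis" "d \<in> Basis" for s t c d
  proof -
    have "norm (s *\<^sub>R c + t *\<^sub>R d) \<le> s + t"
      using norm_triangle_ineq[of "s *\<^sub>R c" "t *\<^sub>R d"] that by simp
    also have "\<dots> < min r1 (min r2 r3)" using that h unfolding h_def by linarith
    finally show ?thesis by (simp add: dist_norm)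
  qed
  have inS: "x + s *\<^sub>R c + t *\<^sub>R d \<in> S"
    if "0 \<le> s" "s \<le> h" "0 \<le> t" "t \<le> h" "c \<in> Basis" "d \<in> Basis" for s t c d
    using near[OF that] r3(2) by simp
  have D1: "(f has_derivative frechet_derivative f (at y)) (at y)" if "y \<in> S" for y
    using Cinf_on_differentiable[OF f that] frechet_derivative_works by blast
  have D2: "((\<lambda>y. frechet_derivative f (at y) c) has_derivative (\<lambda>d. P c d y)) (at y)"
    if "y \<in> S" "c \<in> Basis" for y c unfolding P_def
    using Cinf_on_differentiable[OF Cinf_on_frechet_derivative[OF f that(2)] that(1)]
      frechet_derivative_works by blast
  have diff: "\<exists>s t. 0 < s \<and> s < h \<and> 0 < t \<and> t < h \<and>
      f (x + h *\<^sub>R c + h *\<^sub>R d) - f (x + h *\<^sub>R c) - f (x + h *\<^sub>R d) + f x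
        = h\<^sup>2 * P c d (x + s *\<^sub>R c + t *\<^sub>R d)" if "c \<in> Basis" "d \<in> Basis" for c d
    by (rule second_difference_mvt[where f'' = "\<lambda>y d. P c d y", OF D1 D2[OF _ that(1)]
          inS[OF _ _ _ _ that] h])
  obtain s t where st: "0 < s" "s < h" "0 < t" "t < h" and eq1:
    "f (x + h *\<^sub>R a + h *\<^sub>R b) - f (x + h *\<^sub>R a) - f (x + h *\<^sub>R b) + f x
      = h\<^sup>2 * P a b (x + s *\<^sub>R a + t *\<^sub>R b)"
    using diff[OF ab] by metis
  obtain s' t' where st': "0 < s'" "s' < h" "0 < t'" "t' < h" and eq2:
    "f (x + h *\<^sub>R b + h *\<^sub>R a) - f (x + h *\<^sub>R b) - f (x + h *\<^sub>R a) + f x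
      = h\<^sup>2 * P b a (x + s' *\<^sub>R b + t' *\<^sub>R a)"
    using diff[OF ab(2,1)] by metis
  have "h\<^sup>2 * P a b (x + s *\<^sub>R a + t *\<^sub>R b) = h\<^sup>2 * P b a (x + s' *\<^sub>R b + t' *\<^sub>R a)"
  proof -
    have "f (x + h *\<^sub>R a + h *\<^sub>R b) = f (x + h *\<^sub>R b + h *\<^sub>R a)"
      by (rule arg_cong[of _ _ f]) (simp add: algebra_simps)
    with eq1 eq2 show ?thesis by linarith
  qed
  hence eq: "P a b (x + s *\<^sub>R a + t *\<^sub>R b) = P b a (x + s' *\<^sub>R b + t' *\<^sub>R a)"
    using h by simp
  have "dist (P a b (x + s *\<^sub>R a + t *\<^sub>R b)) (P a b x) < e"
    by (rule r1(2)) (use near[of s t a b] st ab in simp)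
  moreover have "dist (P a b (x + s *\<^sub>R a + t *\<^sub>R b)) (P b a x) < e"
    unfolding eq by (rule r2(2)) (use near[of s' t' b a] st' ab in simp)
  ultimately have "dist (P a b x) (P b a x) < 2 * e"
    using dist_triangle3[of "P a b x" "P b a x" "P a b (x + s *\<^sub>R a + t *\<^sub>R b)"] by linarith
  then show False by (simp add: e_def)
qed

section \<open>Positive semidefinite matrices\<close>

lemma inner_matrix_vector:
  fixes B :: "real^'n::finite^'m::finite"
  shows "v \<bullet> (B *v w) = (\<Sum>i\<in>UNIV. \<Sum>j\<in>UNIV. v $ i * B $ i $ j * w $ j)"
  by (simp add: inner_vec_def matrix_vector_mult_def sum_distrib_left mult.assoc)

lemma inner_symmetric_matrix_commute:
  fixes B :: "real^'n::finite^'n"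
  assumes "transpose B = B"
  shows "w \<bullet> (B *v v) = v \<bullet> (B *v w)"
  by (metis assms dot_lmul_matrix inner_commute transpose_matrix_vector)

lemma quadratic_nonneg_imp_discriminant_le:
  fixes a b c :: real
  assumes "\<And>s. a + 2 * s * b + s\<^sup>2 * c \<ge> 0"
  shows "b\<^sup>2 \<le> a * c"
proof (cases "c = 0")
  case True
  show ?thesis
  proof (cases "b = 0")
    case False
    \<comment> \<open>At this argument the left side equals -1.\<close>
    have "a + 2 * (- (a + 1) / (2 * b)) * b \<ge> 0" using assms[of "- (a + 1) / (2 * b)"] True by simp
    then show ?thesis using False by (simp add: field_simps)
  qed (use True in simp)
next
  case False
  have "c > 0"
  proof (rule ccontr)
    assume "\<not> c > 0"
    then have c: "c < 0" using False by simp
    \<comment> \<open>Chosen so that the quadratic term outweighs a; adding the hypotheses for s and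
      -s removes the linear term.\<close>
    define s where "s = sqrt ((\<bar>a\<bar> + 1) / - c)"
    have "s\<^sup>2 * c = - (\<bar>a\<bar> + 1)" using c by (simp add: s_def field_simps)
    moreover have "a + s\<^sup>2 * c \<ge> 0" using assms[of s] assms[of "- s"] by simp
    ultimately show False by linarith
  qed
  have "0 \<le> a + 2 * (- b / c) * b + (- b / c)\<^sup>2 * c" by (rule assms)
  also have "\<dots> = a - b\<^sup>2 / c" using \<open>c > 0\<close> by (simp add: field_simps power2_eq_square)
  finally show ?thesis using \<open>c > 0\<close> by (simp add: field_simps)
qed

text \<open>Discriminant of the nonnegative quadratic polynomial s to q(v + s w), where q is the
  form of B. The form may vanish on nonzero vectors.\<close>

lemma psd_Cauchy_Schwarz:
  fixes B :: "real^'n::finite^'n"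
  assumes sym: "transpose B = B" and psd: "\<And>v. v \<bullet> (B *v v) \<ge> 0"
  shows "(v \<bullet> (B *v w))\<^sup>2 \<le> (v \<bullet> (B *v v)) * (w \<bullet> (B *v w))"
proof (rule quadratic_nonneg_imp_discriminant_le)
  show "v \<bullet> (B *v v) + 2 * s * (v \<bullet> (B *v w)) + s\<^sup>2 * (w \<bullet> (B *v w)) \<ge> 0" for s
    using psd[of "v + s *\<^sub>R w"] inner_symmetric_matrix_commute[OF sym, of w v]
    by (simp add: matrix_vector_right_distrib matrix_vector_mult_scaleR inner_add_left
        inner_add_right power2_eq_square algebra_simps)
qed

text \<open>
  Cholesky decomposition: subtracting the rank one matrix of a column with nonzero diagonal entry
  keeps the matrix positive semidefinite and clears a row.
\<close>

lemma psd_rank_one_decomposition: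
  fixes B :: "real^'n::finite^'n"
  assumes "transpose B = B" "\<And>v. v \<bullet> (B *v v) \<ge> 0"
  shows "\<exists>V :: (real^'n) list. \<forall>i j. B $ i $ j = (\<Sum>v\<leftarrow>V. v $ i * v $ j)"
  using assms
proof (induction "card {i. B $ i \<noteq> 0}" arbitrary: B rule: less_induct)
  case less
  note sym = less.prems(1) and psd = less.prems(2)
  have symij: "B $ i $ j = B $ j $ i" for i j
    using sym by (metis transpose_def vec_lambda_beta)
  have ax: "v \<bullet> (B *v axis i 1) = (\<Sum>j\<in>UNIV. v $ j * B $ j $ i)" for v i
    by (simp add: matrix_vector_mul_component inner_vec_def matrix_vector_mult_basis column_def)
  have axax: "axis k 1 \<bullet> (B *v axis i 1) = B $ k $ i" for i k
    by (simp add: inner_axis' matrix_vector_mult_basis column_def)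
  show ?case
  proof (cases "\<exists>i. B $ i \<noteq> 0")
    case False
    then have "\<forall>i j. B $ i $ j = (\<Sum>v\<leftarrow>[]. v $ i * v $ j)" by simp
    then show ?thesis by blast
  next
    case True
    then obtain i j where ij: "B $ i $ j \<noteq> 0" by (metis vec_eq_iff zero_index)
    \<comment> \<open>A nonzero entry forces the diagonal entry of its row to be nonzero, which
      provides the pivot.\<close>
    have "(B $ i $ j)\<^sup>2 \<le> B $ i $ i * B $ j $ j"
      using psd_Cauchy_Schwarz[OF sym psd, of "axis i 1" "axis j 1"] by (simp add: axax)
    then have "B $ i $ i \<noteq> 0" using ij by auto
    moreover have "B $ i $ i \<ge> 0" using psd[of "axis i 1"] by (simp add: axax)
    ultimately have pos: "B $ i $ i > 0" by simp
    define C where "C = (\<chi> k l. B $ k $ l - B $ k $ i * B $ l $ i / B $ i $ i)"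
    have C: "v \<bullet> (C *v v) = v \<bullet> (B *v v) - (v \<bullet> (B *v axis i 1))\<^sup>2 / B $ i $ i" for v
      unfolding ax unfolding inner_matrix_vector C_def
      by (simp add: power2_eq_square sum_product sum_divide_distrib sum_subtractf[symmetric]
          algebra_simps)
    have "transpose C = C"
      using symij by (simp add: transpose_def C_def vec_eq_iff mult.commute)
    moreover have "v \<bullet> (C *v v) \<ge> 0" for v
      using psd_Cauchy_Schwarz[OF sym psd, of v "axis i 1"] pos
      unfolding C by (simp add: axax field_simps)
    moreover have "card {i. C $ i \<noteq> 0} < card {i. B $ i \<noteq> 0}"
    proof (rule psubset_card_mono)
      have "C $ k = 0" if "B $ k = 0" for k
        using that by (simp add: C_def vec_eq_iff)
      moreover have "C $ i = 0" using pos symij by (simp add: C_def vec_eq_iff)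
      moreover have "B $ i \<noteq> 0" using ij by auto
      ultimately show "{i. C $ i \<noteq> 0} \<subset> {i. B $ i \<noteq> 0}" by blast
    qed simp
    ultimately obtain V where V: "\<forall>k l. C $ k $ l = (\<Sum>v\<leftarrow>V. v $ k * v $ l)"
      using less.hyps by blast
    define b where "b = (\<chi> k. B $ k $ i / sqrt (B $ i $ i))"
    have "B $ k $ l = (\<Sum>v\<leftarrow>b # V. v $ k * v $ l)" for k l
    proof -
      have "b $ k * b $ l = B $ k $ i * B $ l $ i / B $ i $ i"
        using pos by (simp add: b_def)
      moreover have "(\<Sum>v\<leftarrow>V. v $ k * v $ l) = B $ k $ l - B $ k $ i * B $ l $ i / B $ i $ i"
        by (simp add: C_def flip: V[rule_format])
      ultimately show ?thesis by simp
    qed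
    then show ?thesis by blast
  qed
qed

text \<open>Writing B as a sum of matrices v v^T turns the double sum into a sum of values v . C v.
  With B the inverse metric this gives the sign of the Laplacian at a maximum, and the sign of |K|^2
  for a symmetric tensor K without choosing an orthonormal frame.\<close>

lemma psd_trace_mult_nonneg:
  fixes B C :: "real^'n::finite^'n"
  assumes "transpose B = B" "\<And>v. v \<bullet> (B *v v) \<ge> 0" "\<And>v. v \<bullet> (C *v v) \<ge> 0"
  shows "(\<Sum>i\<in>UNIV. \<Sum>j\<in>UNIV. B $ i $ j * C $ i $ j) \<ge> 0"
proof -
  obtain V where V: "\<And>i j. B $ i $ j = (\<Sum>v\<leftarrow>V. v $ i * v $ j)"
    using psd_rank_one_decomposition[OF assms(1,2)] by blast
  have "(\<Sum>i\<in>UNIV. \<Sum>j\<in>UNIV. (\<Sum>v\<leftarrow>V. v $ i * v $ j) * C $ i $ j) = (\<Sum>v\<leftarrow>V. v \<bullet> (C *v v))"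
  proof (induction V)
    case (Cons a V)
    then show ?case
      by (simp add: inner_matrix_vector distrib_right sum.distrib) (simp add: mult_ac)
  qed simp
  then show ?thesis
    using assms(3) by (auto simp: V intro!: sum_list_nonneg)
qed

text \<open>Coordinate form of |Hess f|^2 \<ge> c^2 when the gradient is an eigenvector with
  eigenvalue c: \<open>B\<close> is the inverse metric, \<open>H\<close> the Hessian,
  \<open>p\<close> the differential and \<open>B *v p\<close> the gradient. The double sum is the
  trace of (B H)^2, that is |Hess f|^2.\<close>

lemma psd_trace_square_ge_eigenvalue:
  fixes B H :: "real^'n::finite^'n"
  assumes B: "transpose B = B" "\<And>v. v \<bullet> (B *v v) \<ge> 0" and H: "transpose H = H"
    and eig: "\<And>i. (\<Sum>j\<in>UNIV. (B ** H) $ i $ j * (B *v p) $ j) = c * (B *v p) $ i"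
    and w: "p \<bullet> (B *v p) > 0"
  shows "c\<^sup>2 \<le> (\<Sum>i\<in>UNIV. \<Sum>j\<in>UNIV. (B ** H) $ i $ j * (B ** H) $ j $ i)"
proof -
  define A where "A = B ** H"
  define X where "X = B *v p"
  define w where "w = p \<bullet> X"
  have w0: "w > 0" using w by (simp add: w_def X_def)
  have ww: "w * w = (\<Sum>i\<in>UNIV. \<Sum>j\<in>UNIV. (p $ i * X $ i) * (p $ j * X $ j))"
    by (simp add: w_def inner_vec_def sum_product)
  \<comment> \<open>\<open>K\<close> is the Hessian with its component along the eigenvector
    removed. Expanding |K|^2 = trace (B K B K) with the eigenvalue equation gives trace ((B H)^2) -
    2 c^2 + c^2, which is nonnegative.\<close>
  define K where "K = (\<chi> i j. H $ i $ j - c / w * p $ i * p $ j)"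
  have K: "transpose K = K"
    using H by (simp add: K_def transpose_def vec_eq_iff)
  have psd: "v \<bullet> ((K ** B ** K) *v v) \<ge> 0" for v
  proof -
    have "v \<bullet> ((K ** B ** K) *v v) = (K *v v) \<bullet> (B *v (K *v v))"
      by (metis K dot_lmul_matrix matrix_vector_mul_assoc transpose_matrix_vector)
    then show ?thesis using B(2) by simp
  qed
  have BK: "(B ** K) $ i $ j = A $ i $ j - c / w * X $ i * p $ j" for i j
    by (simp add: matrix_matrix_mult_def matrix_vector_mult_def K_def A_def X_def
        right_diff_distrib sum_subtractf sum_distrib_left sum_distrib_right mult_ac)
  have Bs: "B $ i $ j = B $ j $ i" for i j
    using arg_cong[OF B(1), of "\<lambda>M. M $ i $ j"] by (simp add: transpose_def)
  have "0 \<le> (\<Sum>i\<in>UNIV. \<Sum>j\<in>UNIV. B $ i $ j * (K ** B ** K) $ i $ j)"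
    by (rule psd_trace_mult_nonneg[OF B psd])
  also have "\<dots> = (\<Sum>i\<in>UNIV. \<Sum>j\<in>UNIV. B $ j $ i * (K ** B ** K) $ i $ j)"
    by (intro sum.cong refl arg_cong2[where f = "(*)"] Bs)
  also have "\<dots> = trace (B ** (K ** B ** K))"
    unfolding trace_def matrix_matrix_mult_def[of B] vec_lambda_beta by (rule sum.swap)
  also have "\<dots> = trace ((B ** K) ** (B ** K))"
    by (simp add: matrix_mul_assoc)
  also have "\<dots> = (\<Sum>i\<in>UNIV. \<Sum>j\<in>UNIV. (B ** K) $ i $ j * (B ** K) $ j $ i)"
    unfolding trace_def matrix_matrix_mult_def[of "B ** K"] vec_lambda_beta ..
  also have "\<dots> = (\<Sum>i\<in>UNIV. \<Sum>j\<in>UNIV. A $ i $ j * A $ j $ i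
      - c / w * (p $ i * (A $ i $ j * X $ j)) - c / w * (p $ j * (A $ j $ i * X $ i))
      + (c / w)\<^sup>2 * ((p $ i * X $ i) * (p $ j * X $ j)))"
    unfolding BK by (intro sum.cong refl) (simp add: power2_eq_square algebra_simps)
  also have "\<dots> = (\<Sum>i\<in>UNIV. \<Sum>j\<in>UNIV. A $ i $ j * A $ j $ i)
      - c / w * (\<Sum>i\<in>UNIV. p $ i * (\<Sum>j\<in>UNIV. A $ i $ j * X $ j))
      - c / w * (\<Sum>i\<in>UNIV. \<Sum>j\<in>UNIV. p $ j * (A $ j $ i * X $ i))
      + (c / w)\<^sup>2 * (w * w)"
    unfolding sum.distrib sum_subtractf ww sum_distrib_left by simp
  also have "(\<Sum>i\<in>UNIV. \<Sum>j\<in>UNIV. p $ j * (A $ j $ i * X $ i))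
      = (\<Sum>j\<in>UNIV. p $ j * (\<Sum>i\<in>UNIV. A $ j $ i * X $ i))"
    unfolding sum_distrib_left by (rule sum.swap)
  also have "(\<Sum>i\<in>UNIV. p $ i * (\<Sum>j\<in>UNIV. A $ i $ j * X $ j)) = c * w"
    unfolding A_def X_def eig
    by (simp add: w_def X_def inner_vec_def sum_distrib_left mult_ac)
  finally show ?thesis
    using w0 by (simp add: A_def power2_eq_square field_simps)
qed

section \<open>Inverse matrices\<close>

lemma pd_invertible:
  fixes B :: "real^'n::finite^'n"
  assumes "\<And>v. v \<noteq> 0 \<Longrightarrow> v \<bullet> (B *v v) > 0"
  shows "invertible B"
proof -
  have "v = 0" if "B *v v = 0" for v
    using assms[of v] that by auto
  then show ?thesis
    unfolding invertible_left_inverse matrix_left_invertible_ker by blast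
qed

lemma matrix_inv_left_right:
  fixes B :: "real^'n::finite^'n"
  assumes "invertible B"
  shows "B ** matrix_inv B = mat 1" "matrix_inv B ** B = mat 1"
  using someI_ex[OF assms[unfolded invertible_def]] by (auto simp: matrix_inv_def)

lemma matrix_inv_vector_mult:
  fixes B :: "real^'n::finite^'n"
  assumes "invertible B"
  shows "B *v (matrix_inv B *v v) = v" "matrix_inv B *v (B *v v) = v"
  using matrix_inv_left_right[OF assms] by (simp_all add: matrix_vector_mul_assoc)

lemma transpose_matrix_inv:
  fixes B :: "real^'n::finite^'n"
  assumes "invertible B" "transpose B = B"
  shows "transpose (matrix_inv B) = matrix_inv B"
proof -
  have *: "transpose (matrix_inv B) ** B = mat 1"
    using matrix_transpose_mul[of B "matrix_inv B"] matrix_inv_left_right(1)[OF assms(1)] assms(2)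
    by (simp add: transpose_mat)
  have "transpose (matrix_inv B) = transpose (matrix_inv B) ** (B ** matrix_inv B)"
    by (simp add: matrix_inv_left_right(1)[OF assms(1)])
  also have "\<dots> = matrix_inv B"
    by (simp add: matrix_mul_assoc *)
  finally show ?thesis .
qed

lemma pd_matrix_inv:
  fixes B :: "real^'n::finite^'n"
  assumes pd: "\<And>v. v \<noteq> 0 \<Longrightarrow> v \<bullet> (B *v v) > 0" and "transpose B = B" and "v \<noteq> 0"
  shows "v \<bullet> (matrix_inv B *v v) > 0"
proof -
  have inv: "invertible B" using pd by (rule pd_invertible)
  have "matrix_inv B *v v \<noteq> 0"
    by (metis assms(3) inv matrix_inv_vector_mult(1) matrix_vector_mult_0_right)
  from pd[OF this] show ?thesis
    by (simp add: matrix_inv_vector_mult[OF inv] inner_commute)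
qed

text \<open>Each entry is a quotient of polynomials in the entries of B with nonvanishing
  denominator. Smoothness of the inverse metric in space and its joint continuity in spacetime both
  rest on this.\<close>

lemma matrix_inv_cramer:
  fixes B :: "real^'n::finite^'n"
  assumes "invertible B"
  shows "matrix_inv B $ k $ l
    = det (\<chi> i j. if j = k then axis l 1 $ i else B $ i $ j) / det B"
proof -
  have "det B \<noteq> 0" using assms by (simp add: invertible_det_nz)
  from cramer[OF this, of "matrix_inv B *v axis l 1" "axis l 1"]
  have "matrix_inv B *v axis l 1 = (\<chi> k. det (\<chi> i j. if j = k then axis l 1 $ i else B $ i $ j) / det B)"
    by (simp add: matrix_inv_vector_mult[OF assms])
  moreover have "(matrix_inv B *v axis l 1) $ k = matrix_inv B $ k $ l"
    by (simp add: matrix_vector_mult_basis column_def)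
  ultimately show ?thesis by simp
qed

section \<open>Partial derivatives\<close>

lemma pderiv_atI: "(f has_derivative f') (at x) \<Longrightarrow> pderiv_at i f x = f' (axis i 1)"
  by (drule frechet_derivative_at) (simp add: pderiv_at_def)

text \<open>Both functions admit the same derivatives at x, so the choice inside
  \<open>frechet_derivative\<close> agrees, whether or not a derivative exists.\<close>

lemma pderiv_at_cong:
  assumes "open S" "x \<in> S" "\<And>y. y \<in> S \<Longrightarrow> f y = g y"
  shows "pderiv_at i f x = pderiv_at i g x"
proof -
  have "(f has_derivative F) (at x) \<longleftrightarrow> (g has_derivative F) (at x)" for F
    using has_derivative_transform_within_open[OF _ assms(1,2), of f F UNIV g]
      has_derivative_transform_within_open[OF _ assms(1,2), of g F UNIV f] assms(3) by auto
  then show ?thesis by (simp add: pderiv_at_def frechet_derivative_def)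
qed

lemma differentiable_cong_open:
  assumes "open S" "x \<in> S" "\<And>y. y \<in> S \<Longrightarrow> f y = g y" "f differentiable (at x)"
  shows "g differentiable (at x)"
  using has_derivative_transform_within_open[OF _ assms(1,2), of f _ UNIV g] assms(3,4)
  unfolding differentiable_def by blast

lemma pderiv_at_add:
  assumes "f differentiable (at x)" "g differentiable (at x)"
  shows "pderiv_at i (\<lambda>x. f x + g x) x = pderiv_at i f x + pderiv_at i g x"
  using pderiv_atI[OF has_derivative_add[OF assms[unfolded frechet_derivative_works]], of i]
  by (simp only: pderiv_at_def)

lemma pderiv_at_diff:
  assumes "f differentiable (at x)" "g differentiable (at x)"
  shows "pderiv_at i (\<lambda>x. f x - g x) x = pderiv_at i f x - pderiv_at i g x"
  using pderiv_atI[OF has_derivative_diff[OF assms[unfolded frechet_derivative_works]], of i]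
  by (simp only: pderiv_at_def)

lemma pderiv_at_mult:
  assumes "f differentiable (at x)" "g differentiable (at x)"
  shows "pderiv_at i (\<lambda>x. f x * g x) x = f x * pderiv_at i g x + pderiv_at i f x * g x"
  using pderiv_atI[OF has_derivative_mult[OF assms[unfolded frechet_derivative_works]], of i]
  by (simp only: pderiv_at_def)

lemma pderiv_at_const: "pderiv_at i (\<lambda>x. c) x = 0"
  by (simp add: pderiv_at_def)

lemma pderiv_at_cmult:
  "f differentiable (at x) \<Longrightarrow> pderiv_at i (\<lambda>x. c * f x) x = c * pderiv_at i f x"
  by (subst pderiv_at_mult) (auto simp: pderiv_at_const)

lemma pderiv_at_sum:
  assumes "\<And>j. j \<in> J \<Longrightarrow> f j differentiable (at x)"
  shows "pderiv_at i (\<lambda>x. \<Sum>j\<in>J. f j x) x = (\<Sum>j\<in>J. pderiv_at i (f j) x)"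
proof -
  have "((\<lambda>x. \<Sum>j\<in>J. f j x) has_derivative (\<lambda>h. \<Sum>j\<in>J. frechet_derivative (f j) (at x) h)) (at x)"
    using assms by (intro has_derivative_sum) (simp add: frechet_derivative_works)
  from pderiv_atI[OF this, of i] show ?thesis by (simp only: pderiv_at_def)
qed

lemma differentiable_sum_fun:
  fixes f :: "'i \<Rightarrow> 'a::real_normed_vector \<Rightarrow> 'b::real_normed_vector"
  assumes "\<And>j. j \<in> J \<Longrightarrow> f j differentiable (at x)"
  shows "(\<lambda>x. \<Sum>j\<in>J. f j x) differentiable (at x)"
  using assms by (induction J rule: infinite_finite_induct) auto

lemma pderiv_at_chain:
  assumes "f differentiable (at x)" "(h has_real_derivative h') (at (f x))"
  shows "pderiv_at i (\<lambda>x. h (f x)) x = h' * pderiv_at i f x"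
    and "(\<lambda>x. h (f x)) differentiable (at x)"
proof -
  have "((\<lambda>x. h (f x)) has_derivative (\<lambda>v. h' * frechet_derivative f (at x) v)) (at x)"
    using diff_chain_at[OF assms(1)[unfolded frechet_derivative_works]
        assms(2)[unfolded has_field_derivative_def]]
    by (simp add: o_def)
  from this pderiv_atI[OF this, of i] show "pderiv_at i (\<lambda>x. h (f x)) x = h' * pderiv_at i f x"
    and "(\<lambda>x. h (f x)) differentiable (at x)"
    by (auto simp only: pderiv_at_def differentiable_def)
qed

lemma Cinf_on_pderiv_at: "Cinf_on f S \<Longrightarrow> Cinf_on (pderiv_at i f) S"
  unfolding pderiv_at_def[abs_def] by (rule Cinf_on_frechet_derivative) auto

lemma pderiv_at_commute:
  assumes "open S" "x \<in> S" "Cinf_on f S"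
  shows "pderiv_at i (pderiv_at j f) x = pderiv_at j (pderiv_at i f) x"
  unfolding pderiv_at_def[abs_def] by (rule frechet_derivative_commute[OF assms]) auto

lemma frechet_derivative_eq_sum_pderiv_at:
  assumes "f differentiable (at x)"
  shows "frechet_derivative f (at x) v = (\<Sum>i\<in>UNIV. v $ i * pderiv_at i f x)"
proof -
  have lin: "linear (frechet_derivative f (at x))"
    using assms by (rule linear_frechet_derivative)
  have "frechet_derivative f (at x) v = frechet_derivative f (at x) (\<Sum>i\<in>UNIV. v $ i *\<^sub>R axis i 1)"
    by (simp add: basis_expansion scalar_mult_eq_scaleR[symmetric])
  also have "\<dots> = (\<Sum>i\<in>UNIV. v $ i * pderiv_at i f x)"
    by (simp add: linear_sum[OF lin] linear_cmul[OF lin] pderiv_at_def)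
  finally show ?thesis .
qed

section \<open>The second derivative test along lines\<close>

lemma has_real_derivative_along_line:
  assumes "f differentiable (at (x + s *\<^sub>R v))"
  shows "((\<lambda>s. f (x + s *\<^sub>R v)) has_real_derivative
    (\<Sum>i\<in>UNIV. v $ i * pderiv_at i f (x + s *\<^sub>R v))) (at s)"
proof -
  define c where "c = (\<lambda>s. x + s *\<^sub>R v)"
  have "(c has_derivative (\<lambda>z. z *\<^sub>R v)) (at s)"
    unfolding c_def by (auto intro!: derivative_eq_intros)
  moreover have "(f has_derivative frechet_derivative f (at (c s))) (at (c s))"
    using assms unfolding c_def frechet_derivative_works .
  ultimately have "(f \<circ> c has_derivative frechet_derivative f (at (c s)) \<circ> (\<lambda>z. z *\<^sub>R v)) (at s)"
    by (rule diff_chain_at)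
  moreover have "frechet_derivative f (at (c s)) \<circ> (\<lambda>z. z *\<^sub>R v)
      = (*) (\<Sum>i\<in>UNIV. v $ i * pderiv_at i f (c s))"
    using assms linear_cmul[OF linear_frechet_derivative[OF assms], of _ v]
      frechet_derivative_eq_sum_pderiv_at[OF assms, of v]
    by (simp add: c_def o_def fun_eq_iff)
  ultimately show ?thesis
    by (simp add: has_field_derivative_def o_def c_def)
qed

text \<open>If c were positive, p' would be positive just to the right of its zero 0, and the mean
  value theorem would make p exceed p 0.\<close>

lemma second_derivative_test_real:
  fixes p :: "real \<Rightarrow> real"
  assumes d: "0 < d" and p: "\<And>s. \<bar>s\<bar> < d \<Longrightarrow> (p has_real_derivative p' s) (at s)"
    and p': "(p' has_real_derivative c) (at 0)" and max: "\<And>s. \<bar>s\<bar> < d \<Longrightarrow> p s \<le> p 0"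
  shows "p' 0 = 0" "c \<le> 0"
proof -
  show 0: "p' 0 = 0"
    by (rule DERIV_local_max[OF p[of 0] d]) (use max d in auto)
  show "c \<le> 0"
  proof (rule ccontr)
    assume "\<not> c \<le> 0"
    then obtain e where e: "e > 0" "\<And>h. 0 < h \<Longrightarrow> h < e \<Longrightarrow> p' 0 < p' (0 + h)"
      using DERIV_pos_inc_right[OF p'] by (metis not_le)
    define s where "s = min d e / 2"
    have s: "0 < s" "s < d" "s < e" using d e(1) by (auto simp: s_def)
    obtain z where z: "0 < z" "z < s" "p s - p 0 = (s - 0) * p' z"
      using MVT2[OF s(1), of p p'] p s(2) by auto
    have "p' z > 0" using e(2)[of z] z(1,2) s(3) 0 by simp
    then have "p s > p 0" using z(3) s(1) by (simp add: algebra_simps)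
    then show False using max[of s] s(1,2) by simp
  qed
qed

lemma second_derivative_test:
  fixes r :: "real^'n::finite \<Rightarrow> real"
  assumes S: "open S" "x \<in> S"
    and r: "\<And>y. y \<in> S \<Longrightarrow> r differentiable (at y)"
    and r': "\<And>i. pderiv_at i r differentiable (at x)"
    and max: "\<And>y. y \<in> S \<Longrightarrow> r y \<le> r x"
  shows "pderiv_at i r x = 0" "v \<bullet> ((\<chi> i j. pderiv_at i (pderiv_at j r) x) *v v) \<le> 0"
proof -
  have main: "(\<Sum>i\<in>UNIV. v $ i * pderiv_at i r x) = 0 \<and>
      (\<Sum>i\<in>UNIV. v $ i * (\<Sum>j\<in>UNIV. v $ j * pderiv_at j (pderiv_at i r) x)) \<le> 0" for v
  proof -
    have "open ((\<lambda>s::real. x + s *\<^sub>R v) -` S)"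
      by (rule open_vimage[OF S(1)]) (intro continuous_intros)
    moreover have "0 \<in> (\<lambda>s::real. x + s *\<^sub>R v) -` S" using S(2) by simp
    ultimately obtain d where "d > 0" "ball 0 d \<subseteq> (\<lambda>s::real. x + s *\<^sub>R v) -` S"
      by (rule openE)
    then have d: "d > 0" "\<And>s. \<bar>s\<bar> < d \<Longrightarrow> x + s *\<^sub>R v \<in> S"
      by (auto simp: subset_iff)
    let ?p = "\<lambda>s. r (x + s *\<^sub>R v)"
    let ?p' = "\<lambda>s. \<Sum>i\<in>UNIV. v $ i * pderiv_at i r (x + s *\<^sub>R v)"
    let ?c = "\<Sum>i\<in>UNIV. v $ i * (\<Sum>j\<in>UNIV. v $ j * pderiv_at j (pderiv_at i r) x)"
    have p: "(?p has_real_derivative ?p' s) (at s)" if "\<bar>s\<bar> < d" for s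
      by (rule has_real_derivative_along_line[OF r[OF d(2)[OF that]]])
    have p': "(?p' has_real_derivative ?c) (at 0)"
    proof (intro DERIV_sum DERIV_cmult)
      fix i
      show "((\<lambda>s. pderiv_at i r (x + s *\<^sub>R v)) has_real_derivative
          (\<Sum>j\<in>UNIV. v $ j * pderiv_at j (pderiv_at i r) x)) (at 0)"
        using has_real_derivative_along_line[of "pderiv_at i r" x 0 v] r' by simp
    qed
    have max': "?p s \<le> ?p 0" if "\<bar>s\<bar> < d" for s
      using max[OF d(2)[OF that]] by simp
    show ?thesis
      using second_derivative_test_real[OF d(1) p p' max'] by simp
  qed
  show "pderiv_at i r x = 0"
    using main[of "axis i 1", THEN conjunct1] by (simp add: axis_def if_distrib if_distribR cong: if_cong)
  have "v \<bullet> ((\<chi> i j. pderiv_at i (pderiv_at j r) x) *v v)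
      = (\<Sum>i\<in>UNIV. \<Sum>j\<in>UNIV. v $ i * pderiv_at i (pderiv_at j r) x * v $ j)"
    unfolding inner_matrix_vector by simp
  \<comment> \<open>Exchanging the sums, rather than the derivatives, matches the order of
    differentiation along the line with that in the matrix.\<close>
  also have "\<dots> = (\<Sum>j\<in>UNIV. \<Sum>i\<in>UNIV. v $ i * pderiv_at i (pderiv_at j r) x * v $ j)"
    by (rule sum.swap)
  also have "\<dots> = (\<Sum>i\<in>UNIV. v $ i * (\<Sum>j\<in>UNIV. v $ j * pderiv_at j (pderiv_at i r) x))"
    by (simp add: sum_distrib_left mult_ac)
  finally show "v \<bullet> ((\<chi> i j. pderiv_at i (pderiv_at j r) x) *v v) \<le> 0"
    using main[of v] by simp
qed

section \<open>Bochner's formula\<close>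

text \<open>
  The index computation behind $\operatorname{div}(\nabla_X X)
  = \operatorname{tr}((\nabla X)^2) + X(\operatorname{div} X) + \operatorname{Ric}(X, X)$ at a
  point: \<open>A k j\<close> is $\nabla_j X^k$ and \<open>dX\<close>, \<open>ddX\<close>, \<open>dC\<close>, \<open>dA\<close> stand for partial derivatives of \<open>X\<close>,
  of the Christoffel symbols \<open>C\<close> and of \<open>A\<close>, the first argument being the direction.
\<close>

lemma div_nabla_algebra:
  fixes X :: "'n::finite \<Rightarrow> real"
  assumes A: "\<And>k j. A k j = dX j k + (\<Sum>l\<in>UNIV. C k j l * X l)"
    and dA: "\<And>i k j. dA i k j = ddX i j k + (\<Sum>l\<in>UNIV. dC i k j l * X l + C k j l * dX i l)"
    and ddX: "\<And>i j k. ddX i j k = ddX j i k"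
    and C: "\<And>k i j. C k i j = C k j i"
  shows "(\<Sum>i\<in>UNIV. (\<Sum>k\<in>UNIV. dA i i k * X k + A i k * dX i k)
      + (\<Sum>l\<in>UNIV. C i i l * (\<Sum>k\<in>UNIV. A l k * X k)))
    = (\<Sum>i\<in>UNIV. \<Sum>k\<in>UNIV. A i k * A k i) + (\<Sum>k\<in>UNIV. X k * (\<Sum>i\<in>UNIV. dA k i i))
      + (\<Sum>j\<in>UNIV. \<Sum>k\<in>UNIV. (\<Sum>i\<in>UNIV. dC i i j k - dC j i i k
          + (\<Sum>m\<in>UNIV. C m j k * C i i m - C m i k * C i j m)) * X j * X k)"
proof -
  let ?S = "\<lambda>f. \<Sum>i\<in>(UNIV :: 'n set). f i"
  \<comment> \<open>These are the terms that remain once every dX is expressed through A and C. On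
    the left E2 cancels between the two parts of the product rule; E0 and E4 occur on both sides;
    the curvature term is E1 - E5 + E6 - E3, which cancels E5 and E6 from the derivative of the
    trace.\<close>
  define E0 where "E0 = ?S (\<lambda>i. ?S (\<lambda>k. ddX i k i * X k))"
  define E1 where "E1 = ?S (\<lambda>i. ?S (\<lambda>k. ?S (\<lambda>l. dC i i k l * X l * X k)))"
  define E2 where "E2 = ?S (\<lambda>i. ?S (\<lambda>k. ?S (\<lambda>l. C i k l * A l i * X k)))"
  define E3 where "E3 = ?S (\<lambda>i. ?S (\<lambda>k. ?S (\<lambda>l. ?S (\<lambda>m. C i k l * C l i m * X m * X k))))"
  define E4 where "E4 = ?S (\<lambda>i. ?S (\<lambda>l. ?S (\<lambda>k. C i i l * A l k * X k)))"
  define E5 where "E5 = ?S (\<lambda>i. ?S (\<lambda>k. ?S (\<lambda>l. dC k i i l * X l * X k)))"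
  define E6 where "E6 = ?S (\<lambda>i. ?S (\<lambda>k. ?S (\<lambda>l. ?S (\<lambda>m. C i i l * C l k m * X m * X k))))"
  define TR where "TR = ?S (\<lambda>i. ?S (\<lambda>k. A i k * A k i))"
  have dX: "dX j k = A k j - ?S (\<lambda>l. C k j l * X l)" for j k
    using A by simp
  have t1: "?S (\<lambda>i. ?S (\<lambda>k. dA i i k * X k)) = E0 + E1 + (E2 - E3)"
    unfolding dA dX E0_def E1_def E2_def E3_def right_diff_distrib left_diff_distrib distrib_right
      sum.distrib sum_subtractf sum_distrib_left sum_distrib_right
    by (simp add: mult_ac)
  have "?S (\<lambda>i. ?S (\<lambda>k. A i k * dX i k)) = TR - ?S (\<lambda>i. ?S (\<lambda>k. ?S (\<lambda>m. A i k * C k i m * X m)))"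
    unfolding dX TR_def right_diff_distrib sum_subtractf sum_distrib_left
    by (simp add: mult_ac)
  also have "?S (\<lambda>i. ?S (\<lambda>k. ?S (\<lambda>m. A i k * C k i m * X m)))
      = ?S (\<lambda>k. ?S (\<lambda>i. ?S (\<lambda>m. A i k * C k i m * X m)))"
    by (rule sum.swap)
  also have "\<dots> = ?S (\<lambda>k. ?S (\<lambda>m. ?S (\<lambda>i. A i k * C k i m * X m)))"
    by (rule sum.cong[OF refl], rule sum.swap)
  also have "\<dots> = E2"
    unfolding E2_def by (intro sum.cong refl, subst C, simp)
  finally have t2: "?S (\<lambda>i. ?S (\<lambda>k. A i k * dX i k)) = TR - E2" .
  have t3: "?S (\<lambda>i. ?S (\<lambda>l. C i i l * ?S (\<lambda>k. A l k * X k))) = E4"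
    unfolding E4_def by (simp add: sum_distrib_left algebra_simps)
  have "?S (\<lambda>k. X k * ?S (\<lambda>i. dA k i i)) = ?S (\<lambda>k. ?S (\<lambda>i. dA k i i * X k))"
    by (simp add: sum_distrib_left mult.commute)
  also have "\<dots> = ?S (\<lambda>i. ?S (\<lambda>k. dA k i i * X k))"
    by (rule sum.swap)
  also have "\<dots> = E0 + E5 + (?S (\<lambda>i. ?S (\<lambda>k. ?S (\<lambda>l. C i i l * A l k * X k))) - E6)"
    unfolding dA dX E0_def E5_def E6_def right_diff_distrib left_diff_distrib distrib_right
      sum.distrib sum_subtractf sum_distrib_left sum_distrib_right
    by (simp add: mult_ac ddX)
  also have "?S (\<lambda>i. ?S (\<lambda>k. ?S (\<lambda>l. C i i l * A l k * X k))) = E4"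
    unfolding E4_def by (rule sum.cong[OF refl], rule sum.swap)
  finally have r2: "?S (\<lambda>k. X k * ?S (\<lambda>i. dA k i i)) = E0 + E5 + (E4 - E6)" .
  have swap3: "?S (\<lambda>j. ?S (\<lambda>k. ?S (\<lambda>i. h i j k))) = ?S (\<lambda>i. ?S (\<lambda>j. ?S (\<lambda>k. h i j k)))"
    for h :: "'n \<Rightarrow> 'n \<Rightarrow> 'n \<Rightarrow> real"
  proof -
    have "?S (\<lambda>j. ?S (\<lambda>k. ?S (\<lambda>i. h i j k))) = ?S (\<lambda>j. ?S (\<lambda>i. ?S (\<lambda>k. h i j k)))"
      by (rule sum.cong[OF refl], rule sum.swap)
    also have "\<dots> = ?S (\<lambda>i. ?S (\<lambda>j. ?S (\<lambda>k. h i j k)))" by (rule sum.swap)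
    finally show ?thesis .
  qed
  have pt: "?S (\<lambda>i. dC i i j k - dC j i i k + ?S (\<lambda>m. C m j k * C i i m - C m i k * C i j m)) * X j * X k
    = ?S (\<lambda>i. dC i i j k * X k * X j) - ?S (\<lambda>i. dC j i i k * X k * X j)
      + ?S (\<lambda>i. ?S (\<lambda>m. C i i m * C m j k * X k * X j))
      - ?S (\<lambda>i. ?S (\<lambda>m. C i j m * C m i k * X k * X j))" for j k
    unfolding sum.distrib sum_subtractf sum_distrib_right distrib_right left_diff_distrib
    by (simp add: mult_ac)
  have "?S (\<lambda>j. ?S (\<lambda>k. ?S (\<lambda>i. dC i i j k - dC j i i k
          + ?S (\<lambda>m. C m j k * C i i m - C m i k * C i j m)) * X j * X k))
    = ?S (\<lambda>j. ?S (\<lambda>k. ?S (\<lambda>i. dC i i j k * X k * X j)))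
      - ?S (\<lambda>j. ?S (\<lambda>k. ?S (\<lambda>i. dC j i i k * X k * X j)))
      + ?S (\<lambda>j. ?S (\<lambda>k. ?S (\<lambda>i. ?S (\<lambda>m. C i i m * C m j k * X k * X j))))
      - ?S (\<lambda>j. ?S (\<lambda>k. ?S (\<lambda>i. ?S (\<lambda>m. C i j m * C m i k * X k * X j))))"
    unfolding pt by (simp only: sum.distrib sum_subtractf)
  also have "?S (\<lambda>j. ?S (\<lambda>k. ?S (\<lambda>i. dC i i j k * X k * X j))) = E1"
    unfolding E1_def by (rule swap3)
  also have "?S (\<lambda>j. ?S (\<lambda>k. ?S (\<lambda>i. dC j i i k * X k * X j))) = E5"
    unfolding E5_def by (rule swap3)
  also have "?S (\<lambda>j. ?S (\<lambda>k. ?S (\<lambda>i. ?S (\<lambda>m. C i i m * C m j k * X k * X j)))) = E6"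
    unfolding E6_def by (rule trans[OF swap3], rule sum.cong[OF refl], rule sum.cong[OF refl], rule sum.swap)
  also have "?S (\<lambda>j. ?S (\<lambda>k. ?S (\<lambda>i. ?S (\<lambda>m. C i j m * C m i k * X k * X j)))) = E3"
    unfolding E3_def by (rule trans[OF swap3], rule sum.cong[OF refl], rule sum.cong[OF refl], rule sum.swap)
  finally have r3: "?S (\<lambda>j. ?S (\<lambda>k. ?S (\<lambda>i. dC i i j k - dC j i i k
      + ?S (\<lambda>m. C m j k * C i i m - C m i k * C i j m)) * X j * X k)) = E1 - E5 + E6 - E3" .
  have "?S (\<lambda>i. ?S (\<lambda>k. dA i i k * X k + A i k * dX i k) + ?S (\<lambda>l. C i i l * ?S (\<lambda>k. A l k * X k)))
    = E0 + E1 + (E2 - E3) + (TR - E2) + E4"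
    unfolding t1[symmetric] t2[symmetric] t3[symmetric] by (simp only: sum.distrib)
  then show ?thesis
    unfolding r2 r3 TR_def[symmetric] by simp
qed

text \<open>The Hessian with one index raised, as the covariant derivative of the gradient field. In
  this form the Laplacian is a plain trace and |Hess f|^2 is the trace of the square, so Bochner's
  formula can be derived without expanding derivatives of the inverse metric.\<close>

definition nabla_gradient ::
  "(real^'n::finite \<Rightarrow> real^'n^'n) \<Rightarrow> (real^'n \<Rightarrow> real) \<Rightarrow> 'n \<Rightarrow> 'n \<Rightarrow> real^'n \<Rightarrow> real" where
  "nabla_gradient G f k j x = pderiv_at j (\<lambda>y. gradient G f y $ k) x
     + (\<Sum>l\<in>UNIV. christoffel G x k j l * gradient G f x $ l)"

text \<open>|grad f|^2 as the differential paired with the gradient: free of square roots, hence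
  smooth also where the gradient vanishes. \<open>grad_norm_in_eq\<close> connects it with
  \<open>metric_norm\<close>.\<close>

definition gradient_norm_sq ::
  "(real^'n::finite \<Rightarrow> real^'n^'n) \<Rightarrow> (real^'n \<Rightarrow> real) \<Rightarrow> real^'n \<Rightarrow> real" where
  "gradient_norm_sq G f x = (\<Sum>m\<in>UNIV. pderiv_at m f x * gradient G f x $ m)"

section \<open>Levi-Civita calculus on a coordinate domain at a fixed time\<close>

locale local_metric =
  fixes G :: "real^'n::finite \<Rightarrow> real^'n^'n" and S :: "(real^'n) set"
  assumes open_S: "open S"
    and smooth_G: "Cinf_on (\<lambda>x. G x $ i $ j) S"
    and sym_G: "x \<in> S \<Longrightarrow> transpose (G x) = G x"
    and pos_G: "x \<in> S \<Longrightarrow> v \<noteq> 0 \<Longrightarrow> v \<bullet> (G x *v v) > 0"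
begin

lemma G_swap: "x \<in> S \<Longrightarrow> G x $ i $ j = G x $ j $ i"
  using arg_cong[OF sym_G, of x "\<lambda>M. M $ i $ j"] by (simp add: transpose_def)

lemma invertible_G: "x \<in> S \<Longrightarrow> invertible (G x)"
  using pos_G by (rule pd_invertible)

lemma transpose_inv_G: "x \<in> S \<Longrightarrow> transpose (matrix_inv (G x)) = matrix_inv (G x)"
  by (rule transpose_matrix_inv[OF invertible_G sym_G])

lemma sum_G_inv_G:
  assumes "x \<in> S"
  shows "(\<Sum>k\<in>UNIV. G x $ m $ k * (\<Sum>l\<in>UNIV. matrix_inv (G x) $ k $ l * b l)) = b m"
  using arg_cong[OF matrix_inv_vector_mult(1)[OF invertible_G[OF assms], of "\<chi> l. b l"], of "\<lambda>v. v $ m"]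
  by (simp add: matrix_vector_mult_def)

lemma sum_inv_G_G:
  assumes "x \<in> S"
  shows "(\<Sum>k\<in>UNIV. matrix_inv (G x) $ m $ k * (\<Sum>l\<in>UNIV. G x $ k $ l * b l)) = b m"
  using arg_cong[OF matrix_inv_vector_mult(2)[OF invertible_G[OF assms], of "\<chi> l. b l"], of "\<lambda>v. v $ m"]
  by (simp add: matrix_vector_mult_def)

lemma smooth_inv_G: "Cinf_on (\<lambda>x. matrix_inv (G x) $ k $ l) S"
proof -
  have det: "Cinf_on (\<lambda>x. det (M x)) S" if "\<And>i j. Cinf_on (\<lambda>x. M x $ i $ j) S"
    for M :: "real^'n \<Rightarrow> real^'n^'n"
    unfolding det_def
    by (intro Cinf_on_sum Cinf_on_mult Cinf_on_prod Cinf_on_const that open_S)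
  show ?thesis
  proof (rule Cinf_on_cong[OF open_S])
    show "det (\<chi> i j. if j = k then axis l 1 $ i else G x $ i $ j) / det (G x)
        = matrix_inv (G x) $ k $ l" if "x \<in> S" for x
      using matrix_inv_cramer[OF invertible_G[OF that]] by simp
    have "Cinf_on (\<lambda>x. (\<chi> i j. if j = k then axis l 1 $ i else G x $ i $ j) $ i $ j) S" for i j
      by (cases "j = k") (simp_all add: Cinf_on_const smooth_G)
    then show "Cinf_on (\<lambda>x. det (\<chi> i j. if j = k then axis l 1 $ i else G x $ i $ j) / det (G x)) S"
      using invertible_G by (intro Cinf_on_divide det smooth_G open_S) (auto simp: invertible_det_nz)
  qed
qed

lemma pderiv_G_swap: "x \<in> S \<Longrightarrow> pderiv_at l (\<lambda>y. G y $ i $ j) x = pderiv_at l (\<lambda>y. G y $ j $ i) x"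
  by (rule pderiv_at_cong[OF open_S _ G_swap])

lemma smooth_christoffel: "Cinf_on (\<lambda>x. christoffel G x k i j) S"
  unfolding christoffel_def
  by (intro Cinf_on_mult Cinf_on_const Cinf_on_sum Cinf_on_add Cinf_on_diff
      Cinf_on_pderiv_at smooth_G smooth_inv_G open_S)

lemma christoffel_swap:
  assumes "x \<in> S"
  shows "christoffel G x k i j = christoffel G x k j i"
  unfolding christoffel_def using pderiv_G_swap[OF assms, of _ i j]
  by (simp add: add.commute)

lemma christoffel_lower:
  assumes "x \<in> S"
  shows "(\<Sum>k\<in>UNIV. G x $ m $ k * christoffel G x k i j) = (1/2) *
    (pderiv_at i (\<lambda>y. G y $ j $ m) x + pderiv_at j (\<lambda>y. G y $ i $ m) x - pderiv_at m (\<lambda>y. G y $ i $ j) x)"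
proof -
  have "(\<Sum>k\<in>UNIV. G x $ m $ k * christoffel G x k i j) = (\<Sum>k\<in>UNIV. (1/2) *
    (G x $ m $ k * (\<Sum>l\<in>UNIV. matrix_inv (G x) $ k $ l *
      (pderiv_at i (\<lambda>y. G y $ j $ l) x + pderiv_at j (\<lambda>y. G y $ i $ l) x - pderiv_at l (\<lambda>y. G y $ i $ j) x))))"
    by (rule sum.cong[OF refl]) (simp add: christoffel_def)
  then show ?thesis unfolding sum_distrib_left[symmetric] sum_G_inv_G[OF assms] .
qed

text \<open>This is nabla g = 0. In the two lowered Christoffel symbols the derivatives in
  directions m and k have opposite signs, so only the derivative in direction j survives.\<close>

lemma metric_compatible:
  assumes "x \<in> S"
  shows "pderiv_at j (\<lambda>y. G y $ m $ k) x
    = (\<Sum>l\<in>UNIV. G x $ k $ l * christoffel G x l j m) + (\<Sum>l\<in>UNIV. G x $ m $ l * christoffel G x l j k)"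
  unfolding christoffel_lower[OF assms] using pderiv_G_swap[OF assms]
  by (simp add: field_simps)

lemma smooth_gradient: "Cinf_on f S \<Longrightarrow> Cinf_on (\<lambda>x. gradient G f x $ k) S"
  by (auto simp: gradient_def matrix_vector_mult_def
      intro!: Cinf_on_sum Cinf_on_mult Cinf_on_pderiv_at smooth_inv_G open_S)

lemma smooth_nabla_gradient: "Cinf_on f S \<Longrightarrow> Cinf_on (nabla_gradient G f k j) S"
  unfolding nabla_gradient_def[abs_def]
  by (intro Cinf_on_add Cinf_on_sum Cinf_on_mult Cinf_on_pderiv_at smooth_gradient
      smooth_christoffel open_S)

lemma smooth_gradient_norm_sq: "Cinf_on f S \<Longrightarrow> Cinf_on (gradient_norm_sq G f) S"
  unfolding gradient_norm_sq_def[abs_def]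
  by (intro Cinf_on_sum Cinf_on_mult Cinf_on_pderiv_at smooth_gradient open_S)

lemma gradient_lower:
  "x \<in> S \<Longrightarrow> (\<Sum>k\<in>UNIV. G x $ m $ k * gradient G f x $ k) = pderiv_at m f x"
  by (simp add: gradient_def matrix_vector_mult_def sum_G_inv_G)

lemma hessian_swap:
  assumes "x \<in> S" "Cinf_on f S"
  shows "hessian G f x $ i $ j = hessian G f x $ j $ i"
  using pderiv_at_commute[OF open_S assms, of i j] christoffel_swap[OF assms(1), of _ i j]
  by (simp add: hessian_def)

text \<open>Differentiate the identity g_{mk} X^k = d_m f for X = grad f and insert nabla g = 0: one
  Christoffel term completes the covariant derivative of X, the other completes the Hessian of
  f.\<close>

lemma nabla_gradient_lower:
  assumes x: "x \<in> S" and f: "Cinf_on f S"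
  shows "(\<Sum>k\<in>UNIV. G x $ m $ k * nabla_gradient G f k j x) = hessian G f x $ j $ m"
proof -
  let ?X = "\<lambda>k. gradient G f x $ k" and ?C = "christoffel G x"
  let ?S = "\<lambda>f. \<Sum>i\<in>(UNIV :: 'n set). f i"
  have dG: "(\<lambda>y. G y $ i $ k) differentiable (at x)" for i k
    using smooth_G x by (rule Cinf_on_differentiable)
  have dX: "(\<lambda>y. gradient G f y $ k) differentiable (at x)" for k
    using smooth_gradient[OF f] x by (rule Cinf_on_differentiable)
  have "pderiv_at j (pderiv_at m f) x = pderiv_at j (\<lambda>y. ?S (\<lambda>k. G y $ m $ k * gradient G f y $ k)) x"
    by (rule pderiv_at_cong[OF open_S x]) (simp add: gradient_lower)
  also have "\<dots> = ?S (\<lambda>k. G x $ m $ k * pderiv_at j (\<lambda>y. gradient G f y $ k) x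
      + pderiv_at j (\<lambda>y. G y $ m $ k) x * ?X k)"
    by (simp add: pderiv_at_sum pderiv_at_mult dG dX)
  also have "\<dots> = ?S (\<lambda>k. G x $ m $ k * pderiv_at j (\<lambda>y. gradient G f y $ k) x)
      + ?S (\<lambda>k. ?S (\<lambda>l. G x $ k $ l * ?C l j m) * ?X k)
      + ?S (\<lambda>k. ?S (\<lambda>l. G x $ m $ l * ?C l j k) * ?X k)"
    unfolding metric_compatible[OF x, of j m] by (simp add: sum.distrib distrib_right)
  also have "?S (\<lambda>k. ?S (\<lambda>l. G x $ k $ l * ?C l j m) * ?X k)
      = ?S (\<lambda>l. ?S (\<lambda>k. G x $ k $ l * ?C l j m * ?X k))"
    unfolding sum_distrib_right by (rule sum.swap)
  also have "\<dots> = ?S (\<lambda>l. ?C l j m * pderiv_at l f x)"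
    unfolding gradient_lower[OF x, where f = f, symmetric] sum_distrib_left
    by (intro sum.cong refl) (simp add: G_swap[OF x] mult_ac)
  also have "?S (\<lambda>k. ?S (\<lambda>l. G x $ m $ l * ?C l j k) * ?X k)
      = ?S (\<lambda>l. ?S (\<lambda>k. G x $ m $ l * ?C l j k * ?X k))"
    unfolding sum_distrib_right by (rule sum.swap)
  also have "\<dots> = ?S (\<lambda>l. G x $ m $ l * ?S (\<lambda>k. ?C l j k * ?X k))"
    by (simp add: sum_distrib_left mult.assoc)
  finally show ?thesis
    by (simp add: hessian_def nabla_gradient_def sum.distrib distrib_left)
qed

lemma nabla_gradient_eq:
  assumes x: "x \<in> S" and f: "Cinf_on f S"
  shows "nabla_gradient G f k j x = (\<Sum>m\<in>UNIV. matrix_inv (G x) $ k $ m * hessian G f x $ j $ m)"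
  using sum_inv_G_G[OF x, of k "\<lambda>k. nabla_gradient G f k j x"]
  by (simp add: nabla_gradient_lower[OF x f])

lemma laplacian_eq_trace:
  assumes "x \<in> S" "Cinf_on f S"
  shows "laplacian G f x = (\<Sum>i\<in>UNIV. nabla_gradient G f i i x)"
  by (simp add: laplacian_def nabla_gradient_eq[OF assms])

text \<open>In the product rule for df(X), X = grad f, the Christoffel terms of the covector and of
  the vector cancel, and each factor contributes Hess f applied to X.\<close>

lemma pderiv_gradient_norm_sq:
  assumes x: "x \<in> S" and f: "Cinf_on f S"
  shows "pderiv_at j (gradient_norm_sq G f) x = 2 * (\<Sum>m\<in>UNIV. hessian G f x $ j $ m * gradient G f x $ m)"
proof -
  let ?X = "\<lambda>k. gradient G f x $ k" and ?C = "christoffel G x"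
  let ?S = "\<lambda>f. \<Sum>i\<in>(UNIV :: 'n set). f i"
  have df: "pderiv_at m f differentiable (at x)" for m
    using Cinf_on_pderiv_at[OF f] x by (rule Cinf_on_differentiable)
  have dX: "(\<lambda>y. gradient G f y $ k) differentiable (at x)" for k
    using smooth_gradient[OF f] x by (rule Cinf_on_differentiable)
  have h: "pderiv_at j (pderiv_at m f) x = hessian G f x $ j $ m + ?S (\<lambda>k. ?C k j m * pderiv_at k f x)" for m
    by (simp add: hessian_def)
  have n: "pderiv_at j (\<lambda>y. gradient G f y $ m) x = nabla_gradient G f m j x - ?S (\<lambda>l. ?C m j l * ?X l)" for m
    by (simp add: nabla_gradient_def)
  have "pderiv_at j (gradient_norm_sq G f) x = ?S (\<lambda>m. pderiv_at m f x * pderiv_at j (\<lambda>y. gradient G f y $ m) x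
      + pderiv_at j (pderiv_at m f) x * ?X m)"
    unfolding gradient_norm_sq_def[abs_def] by (simp add: pderiv_at_sum pderiv_at_mult df dX)
  also have "\<dots> = ?S (\<lambda>m. pderiv_at m f x * nabla_gradient G f m j x)
      - ?S (\<lambda>m. ?S (\<lambda>l. pderiv_at m f x * (?C m j l * ?X l)))
      + ?S (\<lambda>m. hessian G f x $ j $ m * ?X m) + ?S (\<lambda>m. ?S (\<lambda>k. ?C k j m * pderiv_at k f x * ?X m))"
    unfolding h n right_diff_distrib distrib_right sum.distrib sum_subtractf sum_distrib_left sum_distrib_right
    by simp
  also have "?S (\<lambda>m. ?S (\<lambda>k. ?C k j m * pderiv_at k f x * ?X m)) = ?S (\<lambda>k. ?S (\<lambda>m. ?C k j m * pderiv_at k f x * ?X m))"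
    by (rule sum.swap)
  also have "\<dots> = ?S (\<lambda>m. ?S (\<lambda>l. pderiv_at m f x * (?C m j l * ?X l)))"
    by (simp add: mult_ac)
  also have "?S (\<lambda>m. pderiv_at m f x * nabla_gradient G f m j x)
      = ?S (\<lambda>m. ?S (\<lambda>k. G x $ m $ k * ?X k * nabla_gradient G f m j x))"
    unfolding gradient_lower[OF x, where f = f, symmetric] sum_distrib_right ..
  also have "\<dots> = ?S (\<lambda>k. ?S (\<lambda>m. G x $ m $ k * ?X k * nabla_gradient G f m j x))"
    by (rule sum.swap)
  also have "\<dots> = ?S (\<lambda>k. ?S (\<lambda>m. G x $ k $ m * nabla_gradient G f m j x) * ?X k)"
    unfolding sum_distrib_right by (intro sum.cong refl) (simp add: G_swap[OF x] mult_ac)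
  also have "\<dots> = ?S (\<lambda>m. hessian G f x $ j $ m * ?X m)"
    by (simp add: nabla_gradient_lower[OF x f])
  finally show ?thesis by simp
qed

text \<open>For X = grad f this says grad |X|^2 = 2 nabla_X X. It serves twice: it makes the
  Laplacian of |X|^2 the divergence in \<open>div_nabla_algebra\<close>, and it produces the
  eigenvalue equation at the touching point.\<close>

lemma gradient_gradient_norm_sq:
  assumes x: "x \<in> S" and f: "Cinf_on f S"
  shows "gradient G (gradient_norm_sq G f) x $ k = 2 * (\<Sum>m\<in>UNIV. nabla_gradient G f k m x * gradient G f x $ m)"
proof -
  have "gradient G (gradient_norm_sq G f) x $ k = (\<Sum>j\<in>UNIV. matrix_inv (G x) $ k $ j *
      (2 * (\<Sum>m\<in>UNIV. hessian G f x $ j $ m * gradient G f x $ m)))"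
    by (simp add: gradient_def matrix_vector_mult_def pderiv_gradient_norm_sq[OF x f])
  also have "\<dots> = 2 * (\<Sum>j\<in>UNIV. \<Sum>m\<in>UNIV. matrix_inv (G x) $ k $ j * hessian G f x $ m $ j * gradient G f x $ m)"
    by (simp add: sum_distrib_left hessian_swap[OF x f] mult_ac)
  also have "(\<Sum>j\<in>UNIV. \<Sum>m\<in>UNIV. matrix_inv (G x) $ k $ j * hessian G f x $ m $ j * gradient G f x $ m)
      = (\<Sum>m\<in>UNIV. \<Sum>j\<in>UNIV. matrix_inv (G x) $ k $ j * hessian G f x $ m $ j * gradient G f x $ m)"
    by (rule sum.swap)
  finally show ?thesis
    by (simp add: nabla_gradient_eq[OF x f] sum_distrib_right)
qed

text \<open>The divergence identity \<open>div_nabla_algebra\<close> for X = grad f, where div X is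
  the Laplacian of f. The first double sum is |Hess f|^2, as the trace of the square of the mixed
  Hessian.\<close>

lemma bochner:
  assumes x: "x \<in> S" and f: "Cinf_on f S"
  shows "laplacian G (gradient_norm_sq G f) x
    = 2 * (\<Sum>i\<in>UNIV. \<Sum>k\<in>UNIV. nabla_gradient G f i k x * nabla_gradient G f k i x)
      + 2 * (\<Sum>k\<in>UNIV. gradient G f x $ k * pderiv_at k (laplacian G f) x)
      + 2 * (gradient G f x \<bullet> (ricci G x *v gradient G f x))"
proof -
  let ?X = "\<lambda>k. gradient G f x $ k" and ?C = "christoffel G x" and ?N = "nabla_gradient G f"
  let ?S = "\<lambda>f. \<Sum>i\<in>(UNIV :: 'n set). f i"
  let ?dX = "\<lambda>j k. pderiv_at j (\<lambda>y. gradient G f y $ k) x"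
  let ?ddX = "\<lambda>i j k. pderiv_at i (pderiv_at j (\<lambda>y. gradient G f y $ k)) x"
  let ?dC = "\<lambda>i k j l. pderiv_at i (\<lambda>y. christoffel G y k j l) x"
  note diff = Cinf_on_differentiable[OF smooth_christoffel x]
    Cinf_on_differentiable[OF smooth_gradient[OF f] x]
    Cinf_on_differentiable[OF smooth_nabla_gradient[OF f] x]
    Cinf_on_differentiable[OF Cinf_on_pderiv_at[OF smooth_gradient[OF f]] x]
  have dN: "pderiv_at i (?N k j) x = ?ddX i j k + ?S (\<lambda>l. ?dC i k j l * ?X l + ?C k j l * ?dX i l)" for i k j
    unfolding nabla_gradient_def[abs_def]
    by (simp add: pderiv_at_add pderiv_at_sum pderiv_at_mult differentiable_sum_fun diff add.commute)
  have "laplacian G (gradient_norm_sq G f) x = ?S (\<lambda>i. nabla_gradient G (gradient_norm_sq G f) i i x)"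
    by (rule laplacian_eq_trace[OF x smooth_gradient_norm_sq[OF f]])
  also have "\<dots> = ?S (\<lambda>i. 2 * (?S (\<lambda>k. pderiv_at i (?N i k) x * ?X k + ?N i k x * ?dX i k)
      + ?S (\<lambda>l. ?C i i l * ?S (\<lambda>k. ?N l k x * ?X k))))"
  proof (rule sum.cong[OF refl])
    fix i
    have "pderiv_at i (\<lambda>y. gradient G (gradient_norm_sq G f) y $ i) x
        = pderiv_at i (\<lambda>y. 2 * ?S (\<lambda>m. ?N i m y * gradient G f y $ m)) x"
      by (rule pderiv_at_cong[OF open_S x]) (simp add: gradient_gradient_norm_sq f)
    also have "\<dots> = 2 * ?S (\<lambda>k. pderiv_at i (?N i k) x * ?X k + ?N i k x * ?dX i k)"
      by (simp add: pderiv_at_cmult pderiv_at_sum pderiv_at_mult differentiable_sum_fun diff add.commute)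
    finally show "nabla_gradient G (gradient_norm_sq G f) i i x
      = 2 * (?S (\<lambda>k. pderiv_at i (?N i k) x * ?X k + ?N i k x * ?dX i k)
      + ?S (\<lambda>l. ?C i i l * ?S (\<lambda>k. ?N l k x * ?X k)))"
      unfolding nabla_gradient_def[of G "gradient_norm_sq G f"]
      by (simp add: gradient_gradient_norm_sq[OF x f] sum_distrib_left mult_ac)
  qed
  also have "\<dots> = 2 * ?S (\<lambda>i. ?S (\<lambda>k. pderiv_at i (?N i k) x * ?X k + ?N i k x * ?dX i k)
      + ?S (\<lambda>l. ?C i i l * ?S (\<lambda>k. ?N l k x * ?X k)))"
    by (rule sum_distrib_left[symmetric])
  also have "?S (\<lambda>i. ?S (\<lambda>k. pderiv_at i (?N i k) x * ?X k + ?N i k x * ?dX i k)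
      + ?S (\<lambda>l. ?C i i l * ?S (\<lambda>k. ?N l k x * ?X k)))
    = ?S (\<lambda>i. ?S (\<lambda>k. ?N i k x * ?N k i x)) + ?S (\<lambda>k. ?X k * ?S (\<lambda>i. pderiv_at k (?N i i) x))
      + ?S (\<lambda>j. ?S (\<lambda>k. ?S (\<lambda>i. ?dC i i j k - ?dC j i i k
          + ?S (\<lambda>m. ?C m j k * ?C i i m - ?C m i k * ?C i j m)) * ?X j * ?X k))"
    by (rule div_nabla_algebra[of "\<lambda>k j. ?N k j x" ?dX ?C ?X "\<lambda>i k j. pderiv_at i (?N k j) x" ?ddX ?dC])
      (simp_all add: dN nabla_gradient_def pderiv_at_commute[OF open_S x smooth_gradient[OF f]]
        christoffel_swap[OF x])
  also have "?S (\<lambda>k. ?X k * ?S (\<lambda>i. pderiv_at k (?N i i) x)) = ?S (\<lambda>k. ?X k * pderiv_at k (laplacian G f) x)"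
  proof -
    have "pderiv_at k (laplacian G f) x = ?S (\<lambda>i. pderiv_at k (?N i i) x)" for k
    proof -
      have "pderiv_at k (laplacian G f) x = pderiv_at k (\<lambda>y. ?S (\<lambda>i. ?N i i y)) x"
        by (rule pderiv_at_cong[OF open_S x]) (simp add: laplacian_eq_trace f)
      then show ?thesis by (simp add: pderiv_at_sum diff)
    qed
    then show ?thesis by simp
  qed
  also have "?S (\<lambda>j. ?S (\<lambda>k. ?S (\<lambda>i. ?dC i i j k - ?dC j i i k
          + ?S (\<lambda>m. ?C m j k * ?C i i m - ?C m i k * ?C i j m)) * ?X j * ?X k))
      = gradient G f x \<bullet> (ricci G x *v gradient G f x)"
    unfolding inner_matrix_vector ricci_def riemann_def by (simp add: mult_ac)
  finally show ?thesis by (simp add: algebra_simps)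
qed

text \<open>
  This is the maximum principle step at a point where \<open>\<tau> |\<nabla>f|\<^sup>2 \<le> \<kappa> \<psi>(f)\<close> becomes an equality for the
  first time; \<open>time\<close> says that the difference of both sides has not been decreasing in time.
\<close>

lemma no_first_touching:
  assumes x: "x \<in> S" and f: "Cinf_on f S" and \<tau>: "\<tau> > 0" and \<kappa>: "\<kappa> > 1"
    and \<psi>1: "\<And>y. y \<in> S \<Longrightarrow> (\<psi> has_real_derivative \<psi>' (f y)) (at (f y))"
    and \<psi>2: "(\<psi>' has_real_derivative \<psi>'') (at (f x))"
    and pos: "\<psi> (f x) > 0" and rel: "(\<psi>' (f x))\<^sup>2 = 2 * \<psi> (f x) * (\<psi>'' + 1)"
    and max: "\<And>y. y \<in> S \<Longrightarrow> \<tau> * gradient_norm_sq G f y \<le> \<kappa> * \<psi> (f y)"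
    and eq: "\<tau> * gradient_norm_sq G f x = \<kappa> * \<psi> (f x)"
    and time: "0 \<le> gradient_norm_sq G f x
      + \<tau> * (2 * (\<Sum>k\<in>UNIV. gradient G f x $ k * pderiv_at k (laplacian G f) x)
          + 2 * (gradient G f x \<bullet> (ricci G x *v gradient G f x)))
      - \<kappa> * \<psi>' (f x) * laplacian G f x"
  shows False
proof -
  let ?w = "gradient_norm_sq G f" and ?S = "\<lambda>f. \<Sum>i\<in>(UNIV :: 'n set). f i"
  let ?a = "matrix_inv (G x)" and ?X = "gradient G f x"
  define r where "r y = \<tau> * ?w y - \<kappa> * \<psi> (f y)" for y
  have w0: "?w x > 0" using eq \<tau> \<kappa> pos by (metis mult_pos_pos less_trans zero_less_mult_pos zero_less_one)
  have df: "f differentiable (at y)" "pderiv_at i f differentiable (at y)"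
    and dw: "?w differentiable (at y)" "pderiv_at i ?w differentiable (at y)" if "y \<in> S" for y i
    using that f by (auto intro: Cinf_on_differentiable Cinf_on_pderiv_at smooth_gradient_norm_sq)
  have r': "pderiv_at i r y = \<tau> * pderiv_at i ?w y - \<kappa> * (\<psi>' (f y) * pderiv_at i f y)"
    and dr: "r differentiable (at y)" if y: "y \<in> S" for y i
    using pderiv_at_chain[OF df(1)[OF y] \<psi>1[OF y]] dw(1)[OF y] unfolding r_def[abs_def]
    by (simp_all add: pderiv_at_diff pderiv_at_cmult)
  note chain = pderiv_at_chain[OF df(1)[OF x] \<psi>2]
  have r'': "pderiv_at i (pderiv_at j r) x = \<tau> * pderiv_at i (pderiv_at j ?w) x
      - \<kappa> * (\<psi>' (f x) * pderiv_at i (pderiv_at j f) x + \<psi>'' * pderiv_at i f x * pderiv_at j f x)"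
    and dr': "pderiv_at j r differentiable (at x)" for i j
  proof -
    have "pderiv_at i (pderiv_at j r) x
        = pderiv_at i (\<lambda>y. \<tau> * pderiv_at j ?w y - \<kappa> * (\<psi>' (f y) * pderiv_at j f y)) x"
      by (rule pderiv_at_cong[OF open_S x]) (rule r')
    then show "pderiv_at i (pderiv_at j r) x = \<tau> * pderiv_at i (pderiv_at j ?w) x
      - \<kappa> * (\<psi>' (f x) * pderiv_at i (pderiv_at j f) x + \<psi>'' * pderiv_at i f x * pderiv_at j f x)"
      using chain df[OF x] dw[OF x]
      by (simp add: pderiv_at_diff pderiv_at_cmult pderiv_at_mult)
    show "pderiv_at j r differentiable (at x)"
      by (rule differentiable_cong_open[OF open_S x r'[symmetric]])
        (use chain df[OF x] dw[OF x] in auto)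
  qed
  have "r y \<le> r x" if "y \<in> S" for y
    using max[OF that] eq by (simp add: r_def)
  note test = second_derivative_test[OF open_S x dr dr' this]
  \<comment> \<open>Together with grad |grad f|^2 = 2 nabla_X X for X = grad f this yields the
    eigenvalue equation below.\<close>
  have crit: "\<tau> * pderiv_at k ?w x = \<kappa> * (\<psi>' (f x) * pderiv_at k f x)" for k
    using test(1)[of k] r'[OF x, of k] by simp
  have psd: "v \<bullet> (?a *v v) \<ge> 0" for v
    by (cases "v = 0") (auto intro: less_imp_le pd_matrix_inv[OF pos_G[OF x] sym_G[OF x]])
  have "0 \<le> ?S (\<lambda>i. ?S (\<lambda>j. ?a $ i $ j * (- (\<chi> i j. pderiv_at i (pderiv_at j r) x)) $ i $ j))"
    by (rule psd_trace_mult_nonneg[OF transpose_inv_G[OF x] psd])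
      (use test(2) in \<open>simp add: inner_matrix_vector sum_negf\<close>)
  then have "?S (\<lambda>i. ?S (\<lambda>j. ?a $ i $ j * pderiv_at i (pderiv_at j r) x)) \<le> 0"
    by (simp add: sum_negf)
  also have "?S (\<lambda>i. ?S (\<lambda>j. ?a $ i $ j * pderiv_at i (pderiv_at j r) x))
      = ?S (\<lambda>i. ?S (\<lambda>j. ?a $ i $ j * (\<tau> * hessian G ?w x $ i $ j
          - \<kappa> * \<psi>' (f x) * hessian G f x $ i $ j - \<kappa> * \<psi>'' * (pderiv_at i f x * pderiv_at j f x))))"
  \<comment> \<open>The gradient of r vanishes at x, so the Christoffel terms of its Hessian drop
    out and the coordinate second derivatives are the covariant ones. The \<open>\<psi>''\<close>
    term is the square of the differential in the Hessian of \<open>\<psi> (f y)\<close>.\<close>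
  proof (intro sum.cong refl arg_cong2[where f = "(*)"])
    fix i j
    have "\<tau> * ?S (\<lambda>k. christoffel G x k i j * pderiv_at k ?w x)
        = \<kappa> * \<psi>' (f x) * ?S (\<lambda>k. christoffel G x k i j * pderiv_at k f x)"
      unfolding sum_distrib_left
    proof (rule sum.cong[OF refl])
      fix k
      show "\<tau> * (christoffel G x k i j * pderiv_at k ?w x)
        = \<kappa> * \<psi>' (f x) * (christoffel G x k i j * pderiv_at k f x)"
        using arg_cong[OF crit[of k], of "\<lambda>z. christoffel G x k i j * z"] by (simp add: mult_ac)
    qed
    then show "pderiv_at i (pderiv_at j r) x = \<tau> * hessian G ?w x $ i $ j
        - \<kappa> * \<psi>' (f x) * hessian G f x $ i $ j - \<kappa> * \<psi>'' * (pderiv_at i f x * pderiv_at j f x)"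
      unfolding r'' hessian_def by (simp add: algebra_simps)
  qed
  also have "\<dots> = \<tau> * laplacian G ?w x - \<kappa> * \<psi>' (f x) * laplacian G f x
      - \<kappa> * \<psi>'' * ?S (\<lambda>i. ?S (\<lambda>j. ?a $ i $ j * (pderiv_at i f x * pderiv_at j f x)))"
    by (simp add: laplacian_def right_diff_distrib sum_subtractf sum_distrib_left mult_ac)
  also have "?S (\<lambda>i. ?S (\<lambda>j. ?a $ i $ j * (pderiv_at i f x * pderiv_at j f x))) = ?w x"
    by (simp add: gradient_norm_sq_def gradient_def matrix_vector_mult_def sum_distrib_left mult_ac)
  finally have space: "\<tau> * laplacian G ?w x - \<kappa> * \<psi>' (f x) * laplacian G f x - \<kappa> * \<psi>'' * ?w x \<le> 0" .
  \<comment> \<open>The eigenvalue of the Hessian in the direction of the gradient: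
    \<open>crit\<close> says that the differential of |grad f|^2 is 2c times that of f.\<close>
  define c where "c = \<kappa> * \<psi>' (f x) / (2 * \<tau>)"
  define H where "H = hessian G f x"
  define p where "p = (\<chi> i. pderiv_at i f x)"
  have X: "?a *v p = ?X" by (simp add: gradient_def p_def)
  have N: "(?a ** H) $ k $ j = nabla_gradient G f k j x" for k j
    by (simp add: matrix_matrix_mult_def H_def nabla_gradient_eq[OF x f] hessian_swap[OF x f, of j])
  have eig: "?S (\<lambda>m. (?a ** H) $ k $ m * (?a *v p) $ m) = c * (?a *v p) $ k" for k
  proof -
    have "2 * ?S (\<lambda>m. nabla_gradient G f k m x * ?X $ m) = gradient G ?w x $ k"
      by (simp add: gradient_gradient_norm_sq[OF x f])
    also have "\<dots> = ?S (\<lambda>j. ?a $ k $ j * pderiv_at j ?w x)"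
      by (simp add: gradient_def matrix_vector_mult_def)
    also have "\<dots> = ?S (\<lambda>j. 2 * c * (?a $ k $ j * pderiv_at j f x))"
    proof (rule sum.cong[OF refl])
      fix j
      have "pderiv_at j ?w x = 2 * c * pderiv_at j f x"
        using crit[of j] \<tau> by (simp add: c_def field_simps)
      then show "?a $ k $ j * pderiv_at j ?w x = 2 * c * (?a $ k $ j * pderiv_at j f x)" by simp
    qed
    also have "\<dots> = 2 * c * ?X $ k"
      by (simp add: gradient_def matrix_vector_mult_def sum_distrib_left)
    finally show ?thesis unfolding X N by simp
  qed
  have pX: "p \<bullet> (?a *v p) > 0"
    using w0 unfolding X by (simp add: p_def inner_vec_def gradient_norm_sq_def)
  have "transpose H = H"
    using hessian_swap[OF x f] by (simp add: H_def transpose_def vec_eq_iff)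
  from psd_trace_square_ge_eigenvalue[OF transpose_inv_G[OF x] psd this eig pX]
  have trace: "c\<^sup>2 \<le> ?S (\<lambda>i. ?S (\<lambda>k. nabla_gradient G f i k x * nabla_gradient G f k i x))"
    unfolding N .
  \<comment> \<open>\<open>rel\<close> removes the square of \<open>\<psi>'\<close>, then
    \<open>eq\<close> trades \<open>\<kappa> * \<psi> (f x)\<close> for \<tau> |grad f|^2.\<close>
  have "2 * \<tau> * c\<^sup>2 = \<kappa>\<^sup>2 * (\<psi>' (f x))\<^sup>2 / (2 * \<tau>)"
    using \<tau> by (simp add: c_def power2_eq_square)
  also have "\<dots> = \<kappa> * (\<psi>'' + 1) * (\<kappa> * \<psi> (f x)) / \<tau>"
    unfolding rel by (simp add: power2_eq_square)
  also have "\<dots> = \<kappa> * (\<psi>'' + 1) * ?w x"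
    using \<tau> unfolding eq[symmetric] by simp
  finally have c: "2 * \<tau> * c\<^sup>2 = \<kappa> * (\<psi>'' + 1) * ?w x" .
  define TR where "TR = ?S (\<lambda>i. ?S (\<lambda>k. nabla_gradient G f i k x * nabla_gradient G f k i x))"
  have "\<tau> * (2 * ?S (\<lambda>k. ?X $ k * pderiv_at k (laplacian G f) x) + 2 * (?X \<bullet> (ricci G x *v ?X)))
      = \<tau> * laplacian G ?w x - 2 * \<tau> * TR"
    unfolding bochner[OF x f] TR_def[symmetric] by (simp add: algebra_simps)
  with time space have "0 \<le> ?w x + \<kappa> * \<psi>'' * ?w x - 2 * \<tau> * TR" by linarith
  moreover have "2 * \<tau> * c\<^sup>2 \<le> 2 * \<tau> * TR"
    using trace \<tau> unfolding TR_def by simp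
  ultimately have "0 \<le> (1 - \<kappa>) * ?w x" unfolding c by (simp add: algebra_simps)
  then show False using w0 \<kappa> by (simp add: zero_le_mult_iff)
qed

end

section \<open>The Gaussian isoperimetric profile\<close>

text \<open>The centred normal density of variance 2, which is the heat kernel of the real line at
  time 1.\<close>

definition Phi_deriv :: "real \<Rightarrow> real" where
  "Phi_deriv x = (4 * pi) powr (-1/2) * exp (- x\<^sup>2 / 4)"

lemma Phi_deriv_pos: "Phi_deriv x > 0"
  by (simp add: Phi_deriv_def)

lemma has_derivative_Phi: "(Phi has_real_derivative Phi_deriv x) (at x)"
  unfolding Phi_deriv_def by (rule Phi_has_derivative)

lemma has_derivative_Phi_deriv: "(Phi_deriv has_real_derivative (- x / 2 * Phi_deriv x)) (at x)"
  unfolding Phi_deriv_def[abs_def] by (auto intro!: derivative_eq_intros)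

lemma strict_mono_Phi: "strict_mono Phi"
proof (rule strict_monoI)
  show "Phi a < Phi b" if "a < b" for a b
    by (rule DERIV_pos_imp_increasing[OF that]) (use has_derivative_Phi Phi_deriv_pos in blast)
qed

lemma Phi_surj:
  assumes "0 < s" "s < 1"
  obtains x where "Phi x = s"
proof -
  obtain a where a: "Phi a < s"
    using eventually_happens[OF order_tendstoD(2)[OF Phi_at_bot assms(1)]] by auto
  obtain b where b: "s < Phi b"
    using eventually_happens[OF order_tendstoD(1)[OF Phi_at_top assms(2)]] by auto
  have "a < b" using less_trans[OF a b] by (simp add: strict_mono_less[OF strict_mono_Phi])
  moreover have "isCont Phi x" for x
    using has_derivative_Phi by (rule DERIV_isCont)
  ultimately show thesis
    using IVT[of Phi a s b] a b that by auto
qed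

text \<open>Outside (0, 1), the range of \<open>Phi\<close>, this value is unspecified, hence the
  hypotheses 0 < s < 1 below. \<open>profile_sq\<close> is positive everywhere regardless, because
  the density is.\<close>

definition Phi_quantile :: "real \<Rightarrow> real" where
  "Phi_quantile = inv Phi"

lemma Phi_quantile_Phi [simp]: "Phi_quantile (Phi x) = x"
  unfolding Phi_quantile_def by (rule inv_f_f[OF strict_mono_imp_inj_on[OF strict_mono_Phi]])

lemma Phi_Phi_quantile: "0 < s \<Longrightarrow> s < 1 \<Longrightarrow> Phi (Phi_quantile s) = s"
  by (metis Phi_quantile_Phi Phi_surj)

lemma has_derivative_Phi_quantile:
  assumes "0 < s" "s < 1"
  shows "(Phi_quantile has_real_derivative inverse (Phi_deriv (Phi_quantile s))) (at s)"
proof (rule DERIV_inverse_function[where f = Phi and a = 0 and b = 1])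
  show "isCont Phi_quantile s"
    using isCont_inverse_function[of 1 "Phi_quantile s" Phi_quantile Phi]
      DERIV_isCont[OF has_derivative_Phi]
    by (simp add: Phi_Phi_quantile assms)
qed (use assms Phi_deriv_pos in \<open>auto simp: Phi_Phi_quantile less_imp_neq[symmetric] intro: has_derivative_Phi\<close>)

text \<open>By scaling, Phi_\<tau> (sqrt \<tau> x) = Phi x. The time dependence is thus a mere
  factor sqrt \<tau>, which becomes the factor \<tau> in front of |grad u|^2.\<close>

lemma Phi_inv_eq:
  assumes "\<tau> > 0" "0 < s" "s < 1"
  shows "Phi_inv \<tau> s = sqrt \<tau> * Phi_quantile s"
proof -
  have "inj (Phi_scaled \<tau>)"
    using assms(1) by (simp add: inj_on_def Phi_scaled_def strict_mono_eq[OF strict_mono_Phi])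
  moreover have "Phi_scaled \<tau> (sqrt \<tau> * Phi_quantile s) = s"
  proof -
    have "\<tau> powr (- 1 / 2) * sqrt \<tau> = 1"
      using assms(1) by (simp add: powr_minus powr_half_sqrt)
    then have "\<tau> powr (- 1 / 2) * (sqrt \<tau> * Phi_quantile s) = Phi_quantile s"
      by (simp only: mult.assoc[symmetric] mult_1)
    then show ?thesis using assms(2,3) by (simp only: Phi_scaled_def Phi_Phi_quantile)
  qed
  ultimately show ?thesis
    unfolding Phi_inv_def by (metis inv_f_f)
qed

text \<open>The function psi: the Gaussian isoperimetric profile, in the normalisation of variance
  2, squared so that it is compared with |grad u|^2 directly.\<close>

definition profile_sq :: "real \<Rightarrow> real" where
  "profile_sq s = (Phi_deriv (Phi_quantile s))\<^sup>2"

definition profile_sq_deriv :: "real \<Rightarrow> real" where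
  "profile_sq_deriv s = - (Phi_quantile s * Phi_deriv (Phi_quantile s))"

lemma profile_sq_pos: "profile_sq s > 0"
  using Phi_deriv_pos[of "Phi_quantile s"] by (simp add: profile_sq_def)

text \<open>The density satisfies phi'(x) = -x phi(x) / 2, and its factor phi cancels against the
  factor 1/phi from the inverse function.\<close>

lemma has_derivative_Phi_deriv_quantile:
  assumes "0 < s" "s < 1"
  shows "((\<lambda>s. Phi_deriv (Phi_quantile s)) has_real_derivative (- Phi_quantile s / 2)) (at s)"
proof -
  have "- Phi_quantile s / 2 * Phi_deriv (Phi_quantile s) * inverse (Phi_deriv (Phi_quantile s))
      = - Phi_quantile s / 2"
    using Phi_deriv_pos[of "Phi_quantile s"] by simp
  then show ?thesis
    using DERIV_chain2[OF has_derivative_Phi_deriv has_derivative_Phi_quantile[OF assms]]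
    by (simp only:)
qed

lemma has_derivative_profile_sq:
  assumes "0 < s" "s < 1"
  shows "(profile_sq has_real_derivative profile_sq_deriv s) (at s)"
  unfolding profile_sq_def[abs_def] profile_sq_deriv_def
  using DERIV_power[OF has_derivative_Phi_deriv_quantile[OF assms], of 2] by simp

lemma has_derivative_profile_sq_deriv:
  assumes "0 < s" "s < 1"
  shows "(profile_sq_deriv has_real_derivative ((Phi_quantile s)\<^sup>2 / 2 - 1)) (at s)"
  unfolding profile_sq_deriv_def[abs_def]
  using DERIV_minus[OF DERIV_mult[OF has_derivative_Phi_quantile[OF assms]
        has_derivative_Phi_deriv_quantile[OF assms]]] Phi_deriv_pos[of "Phi_quantile s"]
  by (simp add: power2_eq_square)

text \<open>With x the quantile of s one has psi = phi(x)^2, psi' = -x phi(x) and psi'' = x^2/2 - 1,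
  so both sides are x^2 phi(x)^2. This equation adapts the profile to the maximum principle.\<close>

lemma profile_sq_deriv_square:
  "(profile_sq_deriv s)\<^sup>2 = 2 * profile_sq s * (((Phi_quantile s)\<^sup>2 / 2 - 1) + 1)"
  by (simp add: profile_sq_def profile_sq_deriv_def power_mult_distrib)

section \<open>Functions on spacetime\<close>

lemma
  fixes F :: "(real^'n::finite) \<times> real \<Rightarrow> real"
  assumes "F differentiable (at (x, t))"
  shows pderiv_at_space_slice: "pderiv_at i (\<lambda>x. F (x, t)) x = frechet_derivative F (at (x, t)) (axis i 1, 0)"
    and has_derivative_time_slice:
      "((\<lambda>s. F (x, s)) has_real_derivative frechet_derivative F (at (x, t)) (0, 1)) (at t)"
proof -
  have F: "(F has_derivative frechet_derivative F (at (x, t))) (at (x, t))"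
    using assms unfolding frechet_derivative_works .
  have 1: "((\<lambda>x. (x, t)) has_derivative (\<lambda>h. (h, 0))) (at x)"
    by (auto intro!: derivative_eq_intros)
  have 2: "((\<lambda>s. (x, s)) has_derivative (\<lambda>h. (0, h))) (at t)"
    by (auto intro!: derivative_eq_intros)
  show "pderiv_at i (\<lambda>x. F (x, t)) x = frechet_derivative F (at (x, t)) (axis i 1, 0)"
    using pderiv_atI[OF diff_chain_at[OF 1 F], of i] by (simp add: o_def)
  have lin: "frechet_derivative F (at (x, t)) (0, h) = h * frechet_derivative F (at (x, t)) (0, 1)" for h
    using linear_cmul[OF has_derivative_linear[OF F], of h "(0, 1)"] by simp
  have "frechet_derivative F (at (x, t)) \<circ> (\<lambda>h. (0, h)) = (*) (frechet_derivative F (at (x, t)) (0, 1))"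
    by (rule ext) (simp only: o_apply lin[symmetric] mult.commute[of "frechet_derivative F (at (x, t)) (0, 1)"])
  with diff_chain_at[OF 2 F]
  show "((\<lambda>s. F (x, s)) has_real_derivative frechet_derivative F (at (x, t)) (0, 1)) (at t)"
    by (simp add: has_field_derivative_def o_def)
qed

text \<open>Shrinks the neighbourhood of a local extension to a product of balls. \<open>F\<close>
  is smooth across the ends of a time interval, but agrees with \<open>f\<close> only on the
  original set.\<close>

lemma smooth_on_Times_local:
  fixes f :: "'a::euclidean_space \<times> 'b::euclidean_space \<Rightarrow> 'c::real_normed_vector"
  assumes "smooth_on (P \<times> Q) f" "x \<in> P" "y \<in> Q"
  obtains r F where "r > 0" "Cinf_on F (ball x r \<times> ball y r)"
    "\<And>x' y'. x' \<in> ball x r \<Longrightarrow> y' \<in> ball y r \<Longrightarrow> x' \<in> P \<Longrightarrow> y' \<in> Q \<Longrightarrow> F (x', y') = f (x', y')"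
proof -
  have "(x, y) \<in> P \<times> Q" using assms by simp
  then obtain U F where U: "open U" "(x, y) \<in> U" "\<forall>k. Ck_on k F U" "\<forall>z\<in>(P \<times> Q) \<inter> U. F z = f z"
    using assms(1) unfolding smooth_on_def by meson
  obtain V W where VW: "open V" "open W" "x \<in> V" "y \<in> W" "V \<times> W \<subseteq> U"
    using open_prod_elim[OF U(1,2)] by (metis SigmaD1 SigmaD2)
  obtain r1 where r1: "r1 > 0" "ball x r1 \<subseteq> V" using VW(1,3) by (rule openE)
  obtain r2 where r2: "r2 > 0" "ball y r2 \<subseteq> W" using VW(2,4) by (rule openE)
  have sub: "ball x (min r1 r2) \<times> ball y (min r1 r2) \<subseteq> U"
  proof -
    have "ball x (min r1 r2) \<subseteq> V" "ball y (min r1 r2) \<subseteq> W"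
      using r1(2) r2(2) subset_ball[of "min r1 r2"] by (meson min.cobounded1 min.cobounded2 order_trans)+
    then show ?thesis using VW(5) Sigma_mono by (metis (no_types) order_trans)
  qed
  show thesis
  proof (rule that[of "min r1 r2" F])
    show "min r1 r2 > 0" using r1 r2 by simp
    show "Cinf_on F (ball x (min r1 r2) \<times> ball y (min r1 r2))"
      using Ck_on_subset[OF _ sub] U(3) unfolding Cinf_on_def by blast
    show "F (x', y') = f (x', y')"
      if "x' \<in> ball x (min r1 r2)" "y' \<in> ball y (min r1 r2)" "x' \<in> P" "y' \<in> Q" for x' y'
    proof -
      have "(x', y') \<in> U" using sub that(1,2) by blast
      then show ?thesis using U(4) that(3,4) by blast
    qed
  qed
qed

text \<open>Only times up to the touching time are controlled, so the test is one-sided.\<close>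

lemma DERIV_within_left_nonneg:
  fixes f :: "real \<Rightarrow> real"
  assumes "a < b" "(f has_real_derivative D) (at b within {a..b})"
    and "\<And>t. a \<le> t \<Longrightarrow> t \<le> b \<Longrightarrow> f t \<le> f b"
  shows "D \<ge> 0"
proof (rule ccontr)
  assume "\<not> D \<ge> 0"
  then obtain d where d: "d > 0" "\<And>h. h > 0 \<Longrightarrow> b - h \<in> {a..b} \<Longrightarrow> h < d \<Longrightarrow> f b < f (b - h)"
    using has_real_derivative_neg_dec_left[OF assms(2)] by auto
  define h where "h = min d (b - a) / 2"
  have "h > 0" "h < d" "b - h \<in> {a..b}" using d(1) assms(1) by (auto simp: h_def min_def field_simps)
  then show False using d(2)[of h] assms(3)[of "b - h"] by auto
qed

text \<open>Identifies the derivative given by the heat equation, taken within the interval, with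
  the one computed from a smooth extension.\<close>

lemma DERIV_within_left_unique:
  fixes f :: "real \<Rightarrow> real"
  assumes "a < b" "(f has_real_derivative D) (at b within {a..b})"
    "(f has_real_derivative E) (at b within {a..b})"
  shows "D = E"
  using assms unfolding has_field_derivative_iff at_within_Icc_at_left[OF assms(1)]
  by (meson tendsto_unique trivial_limit_at_left_real)

section \<open>Independence of the chart\<close>

lemma gradient_norm_sq_eq_inner:
  "gradient_norm_sq G f x
    = (\<chi> i. pderiv_at i f x) \<bullet> (matrix_inv (G x) *v (\<chi> i. pderiv_at i f x))"
  by (simp add: gradient_norm_sq_def gradient_def inner_vec_def)

lemma gradient_norm_sq_chain:
  assumes "f differentiable (at x)" "(h has_real_derivative h') (at (f x))"
  shows "gradient_norm_sq G (\<lambda>y. h (f y)) x = h'\<^sup>2 * gradient_norm_sq G f x"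
proof -
  have "(\<chi> i. pderiv_at i (\<lambda>y. h (f y)) x) = h' *\<^sub>R (\<chi> i. pderiv_at i f x)"
    by (simp add: vec_eq_iff pderiv_at_chain(1)[OF assms])
  then show ?thesis
    by (simp add: gradient_norm_sq_eq_inner matrix_vector_mult_scaleR power2_eq_square)
qed

text \<open>When the metric transforms by J and covectors by the transpose of J, J carries one
  gradient to the other, so the dual norm is unchanged.\<close>

lemma inverse_metric_pullback:
  fixes B C J :: "real^'n::finite^'n"
  assumes C: "C = transpose J ** B ** J" "invertible C" and B: "invertible B" and q: "q = transpose J *v p"
  shows "q \<bullet> (matrix_inv C *v q) = p \<bullet> (matrix_inv B *v p)"
proof -
  define X where "X = matrix_inv C *v q"
  have "det J \<noteq> 0" using C by (auto simp: invertible_det_nz det_mul)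
  then have inv: "invertible (transpose J)" by (simp add: invertible_det_nz)
  have "transpose J *v (B *v (J *v X)) = C *v X"
    by (simp add: C(1) matrix_vector_mul_assoc matrix_mul_assoc)
  also have "\<dots> = transpose J *v p"
    by (simp add: X_def matrix_inv_vector_mult[OF C(2)] q)
  finally have "B *v (J *v X) = p"
    by (metis inv matrix_inv_vector_mult(2))
  then have "J *v X = matrix_inv B *v p"
    by (metis B matrix_inv_vector_mult(2))
  moreover have "q \<bullet> X = p \<bullet> (J *v X)"
    unfolding q by (simp add: dot_lmul_matrix[symmetric] transpose_matrix_vector)
  ultimately show ?thesis unfolding X_def by simp
qed

lemma riemannian_metric_invertible:
  assumes "riemannian_metric A h" "c \<in> A" "p \<in> chart_dom c"
  shows "invertible (h c p)"
  by (rule pd_invertible) (use assms in \<open>unfold riemannian_metric_def, blast\<close>)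

section \<open>Charts of an atlas and change of coordinates\<close>

locale atlas =
  fixes M :: "'a::t2_space set" and A :: "('a, 'n::finite) chart set"
  assumes atlas: "smooth_atlas M A"
begin

lemma chart:
  assumes "c \<in> A"
  shows "openin (top_of_set M) (chart_dom c)" "open (chart_map c ` chart_dom c)"
    "homeomorphism (chart_dom c) (chart_map c ` chart_dom c) (chart_map c) (chart_inv c)"
  using atlas assms by (auto simp: smooth_atlas_def is_chart_def)

lemma chart_inv_chart_map: "c \<in> A \<Longrightarrow> p \<in> chart_dom c \<Longrightarrow> chart_inv c (chart_map c p) = p"
  using chart(3) by (rule homeomorphism_apply1)

lemma chart_map_chart_inv: "c \<in> A \<Longrightarrow> x \<in> chart_map c ` chart_dom c \<Longrightarrow> chart_map c (chart_inv c x) = x"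
  using chart(3) by (rule homeomorphism_apply2)

lemma chart_inv_in_dom: "c \<in> A \<Longrightarrow> x \<in> chart_map c ` chart_dom c \<Longrightarrow> chart_inv c x \<in> chart_dom c"
  by (auto simp: chart_inv_chart_map)

lemma in_chart_chart_map: "c \<in> A \<Longrightarrow> p \<in> chart_dom c \<Longrightarrow> in_chart c f (chart_map c p) = f p"
  by (simp add: in_chart_def chart_inv_chart_map)

lemma chart_dom_subset: "c \<in> A \<Longrightarrow> chart_dom c \<subseteq> M"
  using chart(1) openin_imp_subset by blast

lemma open_chart_overlap:
  assumes "c \<in> A" "d \<in> A"
  shows "open (chart_map c ` (chart_dom c \<inter> chart_dom d))"
proof -
  obtain T where T: "open T" "chart_dom d = M \<inter> T"
    using chart(1)[OF assms(2)] by (auto simp: openin_open)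
  have "chart_dom c \<inter> chart_dom d = chart_dom c \<inter> T"
    using T(2) chart_dom_subset[OF assms(1)] by auto
  then have "openin (top_of_set (chart_dom c)) (chart_dom c \<inter> chart_dom d)"
    using T(1) by (simp add: openin_open_Int)
  then have "openin (top_of_set (chart_map c ` chart_dom c)) (chart_map c ` (chart_dom c \<inter> chart_dom d))"
    by (rule homeomorphism_imp_open_map[OF chart(3)[OF assms(1)]])
  then show ?thesis using chart(2)[OF assms(1)] by (rule openin_open_trans)
qed

text \<open>\<open>smooth_on\<close> only supplies an extension; as the overlap is open in
  coordinates, the extension coincides with the transition map near the point.\<close>

lemma transition_differentiable:
  assumes "c \<in> A" "d \<in> A" "p \<in> chart_dom c \<inter> chart_dom d"
  shows "transition c d differentiable (at (chart_map c p))"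
proof -
  let ?O = "chart_map c ` (chart_dom c \<inter> chart_dom d)"
  have "smooth_on ?O (transition c d)"
    using atlas assms by (auto simp: smooth_atlas_def)
  moreover have p: "chart_map c p \<in> ?O" using assms(3) by blast
  ultimately obtain U F where U: "open U" "chart_map c p \<in> U" "\<forall>k. Ck_on k F U" "\<forall>z\<in>?O \<inter> U. F z = transition c d z"
    unfolding smooth_on_def by meson
  show ?thesis
  proof (rule differentiable_cong_open)
    show "open (?O \<inter> U)" using open_chart_overlap[OF assms(1,2)] U(1) by blast
    show "F differentiable (at (chart_map c p))"
      using U(2,3) Cinf_on_differentiable unfolding Cinf_on_def by blast
  qed (use U p in auto)
qed

text \<open>The chain rule transforms the differential by the transposed Jacobian, matching the
  transformation law of the metric, so \<open>inverse_metric_pullback\<close> applies.\<close>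

lemma gradient_norm_sq_chart_independent:
  assumes h: "riemannian_metric A h" and c: "c \<in> A" and d: "d \<in> A" and p: "p \<in> chart_dom c \<inter> chart_dom d"
    and f: "in_chart d f differentiable (at (chart_map d p))"
  shows "gradient_norm_sq (in_chart c (h c)) (in_chart c f) (chart_map c p)
    = gradient_norm_sq (in_chart d (h d)) (in_chart d f) (chart_map d p)"
proof -
  let ?O = "chart_map c ` (chart_dom c \<inter> chart_dom d)"
  let ?x = "chart_map c p" and ?y = "chart_map d p"
  define T where "T = frechet_derivative (transition c d) (at ?x)"
  have x: "?x \<in> ?O" using p by blast
  have T: "(transition c d has_derivative T) (at ?x)"
    using transition_differentiable[OF c d p] unfolding T_def frechet_derivative_works .
  have xy: "transition c d ?x = ?y"
    using p by (simp add: transition_def chart_inv_chart_map[OF c])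
  have "(in_chart d f has_derivative frechet_derivative (in_chart d f) (at ?y)) (at (transition c d ?x))"
    using f unfolding xy frechet_derivative_works .
  from diff_chain_at[OF T this]
  have "(in_chart d f \<circ> transition c d has_derivative frechet_derivative (in_chart d f) (at ?y) \<circ> T) (at ?x)" .
  moreover have "in_chart c f y = (in_chart d f \<circ> transition c d) y" if "y \<in> ?O" for y
    using that by (auto simp: in_chart_def transition_def chart_inv_chart_map c d)
  ultimately have "pderiv_at i (in_chart c f) ?x = frechet_derivative (in_chart d f) (at ?y) (T (axis i 1))" for i
    using pderiv_at_cong[OF open_chart_overlap[OF c d] x, of "in_chart c f" "in_chart d f \<circ> transition c d" i]
      pderiv_atI[of "in_chart d f \<circ> transition c d" _ ?x i] by simp
  then have "pderiv_at i (in_chart c f) ?x = (\<Sum>k\<in>UNIV. T (axis i 1) $ k * pderiv_at k (in_chart d f) ?y)" for i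
    by (simp add: frechet_derivative_eq_sum_pderiv_at[OF f])
  then have q: "(\<chi> i. pderiv_at i (in_chart c f) ?x) = transpose (jacobian c d p) *v (\<chi> i. pderiv_at i (in_chart d f) ?y)"
    by (simp add: vec_eq_iff matrix_vector_mult_def transpose_def jacobian_def matrix_def T_def)
  have J: "h c p = transpose (jacobian c d p) ** h d p ** jacobian c d p"
    using h c d p unfolding riemannian_metric_def by blast
  have "invertible (h c p)" "invertible (h d p)"
    using h c d p by (auto intro: riemannian_metric_invertible)
  from inverse_metric_pullback[OF J this q] show ?thesis
    using p by (simp add: gradient_norm_sq_eq_inner in_chart_chart_map c d)
qed

lemma grad_norm_in_eq:
  assumes h: "riemannian_metric A h" and c: "c \<in> A" and p: "p \<in> chart_dom c"
  shows "grad_norm_in c h f p = sqrt (gradient_norm_sq (in_chart c (h c)) (in_chart c f) (chart_map c p))"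
proof -
  have "invertible (h c p)"
    using h c p by (rule riemannian_metric_invertible)
  then show ?thesis
    by (simp add: grad_norm_in_def metric_norm_def gradient_def gradient_norm_sq_eq_inner
        in_chart_chart_map c p matrix_inv_vector_mult inner_commute)
qed

end

section \<open>The maximum principle\<close>

text \<open>Legendre duality: the dual norm squared of p is the maximum of 2 p(X) - |X|^2, attained
  at the gradient. A fixed X thus bounds |grad u|^2 from below at all times, by an expression
  containing the metric but not its inverse.\<close>

lemma two_inner_minus_quadratic_le:
  fixes B :: "real^'n::finite^'n"
  assumes pd: "\<And>v. v \<noteq> 0 \<Longrightarrow> v \<bullet> (B *v v) > 0" and sym: "transpose B = B"
  shows "2 * (p \<bullet> X) - X \<bullet> (B *v X) \<le> p \<bullet> (matrix_inv B *v p)"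
proof -
  define Y where "Y = matrix_inv B *v p"
  have Y: "B *v Y = p"
    unfolding Y_def by (rule matrix_inv_vector_mult(1)[OF pd_invertible[OF pd]])
  have "0 \<le> (X - Y) \<bullet> (B *v (X - Y))"
    using pd[of "X - Y"] by (cases "X = Y") (auto intro: less_imp_le)
  also have "\<dots> = X \<bullet> (B *v X) - 2 * (p \<bullet> X) + p \<bullet> Y"
    using inner_symmetric_matrix_commute[OF sym, of X Y]
    by (simp add: matrix_vector_mult_diff_distrib inner_diff_left inner_diff_right Y inner_commute)
  finally show ?thesis unfolding Y_def by simp
qed

lemma (in atlas) continuous_on_spacetimeI:
  fixes h :: "'a \<times> real \<Rightarrow> 'b::topological_space"
  assumes "\<And>c x t. c \<in> A \<Longrightarrow> x \<in> chart_map c ` chart_dom c \<Longrightarrow> t \<in> J \<Longrightarrow>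
    \<exists>r>0. ball x r \<subseteq> chart_map c ` chart_dom c \<and>
      continuous_on (ball x r \<times> (ball t r \<inter> J)) (\<lambda>(y, s). h (chart_inv c y, s))"
  shows "continuous_on (M \<times> J) h"
  unfolding continuous_on_eq_continuous_within
proof safe
  fix p t assume p: "p \<in> M" and t: "t \<in> J"
  obtain c where c: "c \<in> A" "p \<in> chart_dom c" using atlas p by (auto simp: smooth_atlas_def)
  define x where "x = chart_map c p"
  have "x \<in> chart_map c ` chart_dom c" using c by (simp add: x_def)
  from assms[OF c(1) this t] obtain r where r: "r > 0" "ball x r \<subseteq> chart_map c ` chart_dom c"
    and cont: "continuous_on (ball x r \<times> (ball t r \<inter> J)) (\<lambda>(y, s). h (chart_inv c y, s))"
    by blast
  define W where "W = chart_dom c \<inter> chart_map c -` ball x r"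
  have cc: "continuous_on (chart_dom c) (chart_map c)"
    using chart(3)[OF c(1)] by (simp add: homeomorphism_def)
  have "openin (top_of_set (chart_dom c)) W"
    unfolding W_def using cc by (rule continuous_openin_preimage_gen) simp
  then have "openin (top_of_set M) W"
    using chart(1)[OF c(1)] by (rule openin_trans)
  then obtain V where V: "open V" "W = M \<inter> V" by (auto simp: openin_open)
  have "continuous_on (W \<times> (ball t r \<inter> J)) (\<lambda>z. (chart_map c (fst z), snd z))"
    by (intro continuous_intros continuous_on_compose2[OF cc]) (auto simp: W_def)
  then have "continuous_on (W \<times> (ball t r \<inter> J))
      (\<lambda>z. case (chart_map c (fst z), snd z) of (y, s) \<Rightarrow> h (chart_inv c y, s))"
    by (rule continuous_on_compose2[OF cont]) (auto simp: W_def)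
  then have "continuous_on (W \<times> (ball t r \<inter> J)) h"
    by (rule continuous_on_eq) (auto simp: W_def chart_inv_chart_map c)
  moreover have pt: "(p, t) \<in> W \<times> (ball t r \<inter> J)"
    using c r(1) t by (simp add: W_def x_def)
  ultimately have "continuous (at (p, t) within W \<times> (ball t r \<inter> J)) h"
    by (simp add: continuous_on_eq_continuous_within)
  moreover have "at (p, t) within W \<times> (ball t r \<inter> J) = at (p, t) within M \<times> J"
    by (rule at_within_nhd[of _ "V \<times> ball t r"]) (use pt V in \<open>auto intro: open_Times\<close>)
  ultimately show "continuous (at (p, t) within M \<times> J) h" by simp
qed

section \<open>The solution and the evolving metric in charts\<close>

locale heat_on_super_ricci_flow = atlas M A
  for M :: "'a::t2_space set" and A :: "('a, 'n::finite) chart set" +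
  fixes I :: "real set" and g :: "real \<Rightarrow> ('a, 'n) tensor2" and u :: "'a \<Rightarrow> real \<Rightarrow> real"
    and t0 t1 :: real
  assumes flow: "super_ricci_flow A I g" and subset_I: "{t0..t1} \<subseteq> I"
    and heat: "heat_solution A {t0..t1} g u"
    and u_range: "\<And>p t. p \<in> M \<Longrightarrow> t \<in> {t0..t1} \<Longrightarrow> u p t \<in> {0<..<1}"
begin

abbreviation metric :: "('a, 'n) chart \<Rightarrow> real \<Rightarrow> real^'n \<Rightarrow> real^'n^'n" where
  "metric c t \<equiv> in_chart c (g t c)"

abbreviation sol :: "('a, 'n) chart \<Rightarrow> real \<Rightarrow> real^'n \<Rightarrow> real" where
  "sol c t \<equiv> in_chart c (\<lambda>q. u q t)"

lemma riemannian: "t \<in> {t0..t1} \<Longrightarrow> riemannian_metric A (g t)"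
  using flow subset_I unfolding super_ricci_flow_def by blast

lemma metric_pos:
  assumes "c \<in> A" "x \<in> chart_map c ` chart_dom c" "t \<in> {t0..t1}"
  shows "transpose (metric c t x) = metric c t x" "v \<noteq> 0 \<Longrightarrow> v \<bullet> (metric c t x *v v) > 0"
  using riemannian[OF assms(3)] assms(1) chart_inv_in_dom[OF assms(1,2)]
  unfolding riemannian_metric_def in_chart_def o_apply by blast+

text \<open>One radius serves both extensions. Their arguments come in opposite order, space first
  in \<open>F\<close> and time first in \<open>E\<close>, following
  \<open>smooth_on_spacetime\<close> and \<open>smooth_family\<close>.\<close>

lemma local_extension:
  assumes c: "c \<in> A" and x: "x \<in> chart_map c ` chart_dom c" and t: "t \<in> {t0..t1}"
  obtains r F E where "r > 0" "ball x r \<subseteq> chart_map c ` chart_dom c"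
    "Cinf_on F (ball x r \<times> ball t r)" "Cinf_on E (ball t r \<times> ball x r)"
    "\<And>y s. y \<in> ball x r \<Longrightarrow> s \<in> ball t r \<Longrightarrow> s \<in> {t0..t1} \<Longrightarrow> F (y, s) = sol c s y"
    "\<And>y s. y \<in> ball x r \<Longrightarrow> s \<in> ball t r \<Longrightarrow> s \<in> {t0..t1} \<Longrightarrow> E (s, y) = metric c s y"
proof -
  let ?U = "chart_map c ` chart_dom c"
  have sm: "smooth_on (?U \<times> {t0..t1}) (\<lambda>(x, t). u (chart_inv c x) t)"
    using heat c by (auto simp: heat_solution_def smooth_on_spacetime_def)
  obtain r1 F where 1: "r1 > 0" "Cinf_on F (ball x r1 \<times> ball t r1)"
    "\<And>y s. y \<in> ball x r1 \<Longrightarrow> s \<in> ball t r1 \<Longrightarrow> y \<in> ?U \<Longrightarrow> s \<in> {t0..t1}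
      \<Longrightarrow> F (y, s) = (\<lambda>(x, t). u (chart_inv c x) t) (y, s)"
    by (rule smooth_on_Times_local[OF sm x t]) (rule that)
  have tI: "t \<in> I" using t subset_I by blast
  have sm': "smooth_on (I \<times> ?U) (\<lambda>(t, x). g t c (chart_inv c x))"
    using flow c by (auto simp: super_ricci_flow_def smooth_family_def)
  obtain r2 E where 2: "r2 > 0" "Cinf_on E (ball t r2 \<times> ball x r2)"
    "\<And>s y. s \<in> ball t r2 \<Longrightarrow> y \<in> ball x r2 \<Longrightarrow> s \<in> I \<Longrightarrow> y \<in> ?U
      \<Longrightarrow> E (s, y) = (\<lambda>(t, x). g t c (chart_inv c x)) (s, y)"
    by (rule smooth_on_Times_local[OF sm' tI x]) (rule that)
  obtain r3 where 3: "r3 > 0" "ball x r3 \<subseteq> ?U" using chart(2)[OF c] x by (rule openE)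
  define r where "r = min r1 (min r2 r3)"
  have r: "r > 0" "r \<le> r1" "r \<le> r2" "r \<le> r3" using 1(1) 2(1) 3(1) by (auto simp: r_def)
  have sub: "ball x r \<subseteq> ?U" using 3(2) subset_ball[OF r(4)] by blast
  show thesis
  proof (rule that[OF r(1) sub])
    show "Cinf_on F (ball x r \<times> ball t r)"
      by (rule Cinf_on_subset[OF 1(2) Sigma_mono]) (use r(2) in auto)
    show "Cinf_on E (ball t r \<times> ball x r)"
      by (rule Cinf_on_subset[OF 2(2) Sigma_mono]) (use r(3) in auto)
    fix y s assume ys: "y \<in> ball x r" "s \<in> ball t r" "s \<in> {t0..t1}"
    then have yU: "y \<in> ?U" and sI: "s \<in> I" using sub subset_I by auto
    show "F (y, s) = sol c s y"
      using 1(3)[OF _ _ yU ys(3)] ys(1,2) r(2) by (simp add: in_chart_def)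
    show "E (s, y) = metric c s y"
      using 2(3)[OF _ _ sI yU] ys(1,2) r(3) by (simp add: in_chart_def)
  qed
qed

lemma local_smooth:
  assumes c: "c \<in> A" and x: "x \<in> chart_map c ` chart_dom c" and t: "t \<in> {t0..t1}"
  obtains r where "r > 0" "ball x r \<subseteq> chart_map c ` chart_dom c"
    "Cinf_on (sol c t) (ball x r)" "local_metric (metric c t) (ball x r)"
proof -
  obtain r F E where r: "r > 0" "ball x r \<subseteq> chart_map c ` chart_dom c"
    and F: "Cinf_on F (ball x r \<times> ball t r)" and E: "Cinf_on E (ball t r \<times> ball x r)"
    and Feq: "\<And>y s. y \<in> ball x r \<Longrightarrow> s \<in> ball t r \<Longrightarrow> s \<in> {t0..t1} \<Longrightarrow> F (y, s) = sol c s y"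
    and Eeq: "\<And>y s. y \<in> ball x r \<Longrightarrow> s \<in> ball t r \<Longrightarrow> s \<in> {t0..t1} \<Longrightarrow> E (s, y) = metric c s y"
    by (rule local_extension[OF assms]) (rule that)
  have tt: "t \<in> ball t r" using r(1) by simp
  have "Cinf_on (\<lambda>y. F (y, t)) (ball x r)"
    using Cinf_on_Pair_right[OF open_Times[OF open_ball open_ball] F, of t] tt
    by (simp only: mem_Times_iff fst_conv snd_conv simp_thms Collect_mem_eq)
  then have "Cinf_on (sol c t) (ball x r)"
    by (rule Cinf_on_cong[rotated -1]) (use Feq tt t in auto)
  moreover have "local_metric (metric c t) (ball x r)"
  proof
    show "Cinf_on (\<lambda>y. metric c t y $ i $ j) (ball x r)" for i j
    proof -
      have "Cinf_on (\<lambda>y. E (t, y)) (ball x r)"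
        using Cinf_on_Pair_left[OF open_Times[OF open_ball open_ball] E, of t] tt
        by (simp only: mem_Times_iff fst_conv snd_conv simp_thms Collect_mem_eq)
      then have "Cinf_on (\<lambda>y. E (t, y) $ i $ j) (ball x r)"
        by (intro Cinf_on_bounded_linear[where L = "\<lambda>M. M $ i $ j"])
          (auto intro: bounded_linear_compose[OF bounded_linear_vec_nth bounded_linear_vec_nth])
      then show ?thesis
        by (rule Cinf_on_cong[rotated -1]) (use Eeq tt t in auto)
    qed
  qed (use metric_pos[OF c _ t] r(2) in auto)
  ultimately show thesis using that r by blast
qed

lemma continuous_on_u: "continuous_on (M \<times> {t0..t1}) (\<lambda>(p, t). u p t)"
proof (rule continuous_on_spacetimeI)
  fix c x t assume c: "c \<in> A" and x: "x \<in> chart_map c ` chart_dom c" and t: "t \<in> {t0..t1}"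
  obtain r F E where r: "r > 0" "ball x r \<subseteq> chart_map c ` chart_dom c"
    and F: "Cinf_on F (ball x r \<times> ball t r)" and E: "Cinf_on E (ball t r \<times> ball x r)"
    and Feq: "\<And>y s. y \<in> ball x r \<Longrightarrow> s \<in> ball t r \<Longrightarrow> s \<in> {t0..t1} \<Longrightarrow> F (y, s) = sol c s y"
    and Eeq: "\<And>y s. y \<in> ball x r \<Longrightarrow> s \<in> ball t r \<Longrightarrow> s \<in> {t0..t1} \<Longrightarrow> E (s, y) = metric c s y"
    by (rule local_extension[OF c x t]) (rule that)
  have "continuous_on (ball x r \<times> (ball t r \<inter> {t0..t1})) F"
    by (rule continuous_on_subset[OF Cinf_on_continuous_on[OF F]]) auto
  then have "continuous_on (ball x r \<times> (ball t r \<inter> {t0..t1}))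
      (\<lambda>(y, s). (\<lambda>(p, t). u p t) (chart_inv c y, s))"
    by (rule continuous_on_eq) (auto simp: Feq in_chart_def)
  then show "\<exists>r>0. ball x r \<subseteq> chart_map c ` chart_dom c \<and>
      continuous_on (ball x r \<times> (ball t r \<inter> {t0..t1})) (\<lambda>(y, s). (\<lambda>(p, t). u p t) (chart_inv c y, s))"
    using r by blast
qed

text \<open>A function on the manifold rather than in a chart, as the first touching time is sought
  over all points at once. \<open>grad_sq_eq\<close> removes the dependence on the chosen
  chart.\<close>

definition grad_sq :: "'a \<Rightarrow> real \<Rightarrow> real" where
  "grad_sq p t = (let c = SOME c. c \<in> A \<and> p \<in> chart_dom c
     in gradient_norm_sq (metric c t) (sol c t) (chart_map c p))"

lemma grad_sq_eq:
  assumes c: "c \<in> A" and p: "p \<in> chart_dom c" and t: "t \<in> {t0..t1}"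
  shows "grad_sq p t = gradient_norm_sq (metric c t) (sol c t) (chart_map c p)"
proof -
  define d where "d = (SOME c. c \<in> A \<and> p \<in> chart_dom c)"
  have "d \<in> A \<and> p \<in> chart_dom d" unfolding d_def by (rule someI[of _ c]) (use c p in blast)
  then have d: "d \<in> A" "p \<in> chart_dom d" by auto
  obtain r where r: "r > 0" "ball (chart_map c p) r \<subseteq> chart_map c ` chart_dom c"
    "Cinf_on (sol c t) (ball (chart_map c p) r)" "local_metric (metric c t) (ball (chart_map c p) r)"
    by (rule local_smooth[OF c imageI[OF p] t]) (rule that)
  have "sol c t differentiable (at (chart_map c p))"
    by (rule Cinf_on_differentiable[OF r(3)]) (use r(1) in simp)
  then show ?thesis
    using gradient_norm_sq_chart_independent[OF riemannian[OF t] d(1) c, of p] d p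
    by (simp add: grad_sq_def Let_def d_def[symmetric])
qed

lemma continuous_on_grad_sq: "continuous_on (M \<times> {t0..t1}) (\<lambda>(p, t). grad_sq p t)"
proof (rule continuous_on_spacetimeI)
  fix c x t assume c: "c \<in> A" and x: "x \<in> chart_map c ` chart_dom c" and t: "t \<in> {t0..t1}"
  obtain r F E where r: "r > 0" and sub: "ball x r \<subseteq> chart_map c ` chart_dom c"
    and F: "Cinf_on F (ball x r \<times> ball t r)" and E: "Cinf_on E (ball t r \<times> ball x r)"
    and Feq: "\<And>y s. y \<in> ball x r \<Longrightarrow> s \<in> ball t r \<Longrightarrow> s \<in> {t0..t1} \<Longrightarrow> F (y, s) = sol c s y"
    and Eeq: "\<And>y s. y \<in> ball x r \<Longrightarrow> s \<in> ball t r \<Longrightarrow> s \<in> {t0..t1} \<Longrightarrow> E (s, y) = metric c s y"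
    by (rule local_extension[OF c x t]) (rule that)
  let ?S = "ball x r \<times> (ball t r \<inter> {t0..t1})"
  \<comment> \<open>\<open>P\<close> and \<open>a\<close> express the differential and the inverse
    metric through the extensions, where joint continuity in space and time is available; Cramer's
    rule handles the inverse.\<close>
  define P where "P m z = frechet_derivative F (at z) (axis m 1, 0)" for m z
  define a where "a k l z = det (\<chi> i j. if j = k then axis l 1 $ i else E (snd z, fst z) $ i $ j)
    / det (E (snd z, fst z))" for k l :: 'n and z
  have inv: "invertible (E (s, y))" if "(y, s) \<in> ?S" for y s
    using that metric_pos(2)[OF c, of y s] sub by (auto simp: Eeq intro!: pd_invertible)
  have contP: "continuous_on ?S (P m)" for m
    unfolding P_def
    by (rule continuous_on_subset[OF Cinf_on_continuous_on[OF Cinf_on_frechet_derivative[OF F]]])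
      (auto simp: Basis_prod_def)
  have det: "continuous_on ?S (\<lambda>z. det (H z))" if "\<And>i j. continuous_on ?S (\<lambda>z. H z $ i $ j)"
    for H :: "_ \<Rightarrow> real^'n^'n"
    unfolding det_def by (intro continuous_intros that)
  have contE: "continuous_on ?S (\<lambda>z. E (snd z, fst z))"
    by (rule continuous_on_compose2[OF Cinf_on_continuous_on[OF E]]) (auto intro!: continuous_intros)
  have entry: "continuous_on ?S (\<lambda>z. (\<chi> i j. if j = k then axis l 1 $ i else E (snd z, fst z) $ i $ j) $ i $ j)"
    for k l i j
    by (cases "j = k") (auto intro!: continuous_intros contE)
  have conta: "continuous_on ?S (a k l)" for k l
    unfolding a_def
    by (intro continuous_on_divide det entry) (use inv in \<open>auto intro!: continuous_intros contE simp: invertible_det_nz\<close>)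
  have "continuous_on ?S (\<lambda>z. \<Sum>m\<in>UNIV. P m z * (\<Sum>l\<in>UNIV. a m l z * P l z))"
    by (intro continuous_intros contP conta)
  then have "continuous_on ?S (\<lambda>(y, s). (\<lambda>(p, t). grad_sq p t) (chart_inv c y, s))"
  proof (rule continuous_on_eq)
    fix z assume z: "z \<in> ?S"
    obtain y s where ys: "z = (y, s)" by force
    with z have y: "y \<in> ball x r" and s: "s \<in> ball t r" "s \<in> {t0..t1}" by auto
    have P: "P m z = pderiv_at m (sol c s) y" for m
    proof -
      have "pderiv_at m (sol c s) y = pderiv_at m (\<lambda>y. F (y, s)) y"
        by (rule pderiv_at_cong[OF open_ball y]) (rule Feq[OF _ s, symmetric])
      also have "\<dots> = P m z"
        unfolding P_def ys
        by (rule pderiv_at_space_slice[OF Cinf_on_differentiable[OF F]]) (use y s in auto)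
      finally show ?thesis ..
    qed
    have a: "a k l z = matrix_inv (metric c s y) $ k $ l" for k l
    proof -
      have "a k l z = matrix_inv (E (s, y)) $ k $ l"
        unfolding a_def ys fst_conv snd_conv
        by (rule matrix_inv_cramer[OF inv, symmetric]) (use z ys in simp)
      then show ?thesis by (simp only: Eeq[OF y s])
    qed
    have yU: "y \<in> chart_map c ` chart_dom c" using y sub by blast
    have "grad_sq (chart_inv c y) s = gradient_norm_sq (metric c s) (sol c s) y"
      using grad_sq_eq[OF c chart_inv_in_dom[OF c yU] s(2)] by (simp add: chart_map_chart_inv[OF c yU])
    then show "(\<Sum>m\<in>UNIV. P m z * (\<Sum>l\<in>UNIV. a m l z * P l z))
        = (case z of (y, s) \<Rightarrow> (\<lambda>(p, t). grad_sq p t) (chart_inv c y, s))"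
      by (simp add: ys P[unfolded ys] a[unfolded ys] gradient_norm_sq_def gradient_def matrix_vector_mult_def)
  qed
  then show "\<exists>r>0. ball x r \<subseteq> chart_map c ` chart_dom c \<and>
      continuous_on (ball x r \<times> (ball t r \<inter> {t0..t1})) (\<lambda>(y, s). (\<lambda>(p, t). grad_sq p t) (chart_inv c y, s))"
    using r sub by blast
qed

section \<open>Exclusion of a first touching point\<close>

lemma sol_range:
  assumes "c \<in> A" "x \<in> chart_map c ` chart_dom c" "t \<in> {t0..t1}"
  shows "0 < sol c t x" "sol c t x < 1"
  using u_range[OF _ assms(3)] chart_inv_in_dom[OF assms(1,2)] chart_dom_subset[OF assms(1)]
  by (auto simp: in_chart_def)

text \<open>Up to time t the difference of the two sides at p is at most zero, and it is zero at t,
  so a left derivative there is nonnegative. The heat equation replaces the time derivative of u by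
  the Laplacian, and the flow inequality replaces that of the metric by Ricci curvature. The result
  is the hypothesis \<open>time\<close> of \<open>no_first_touching\<close>.\<close>

lemma touching_time_inequality:
  assumes c: "c \<in> A" and p: "p \<in> chart_dom c" and t: "t \<in> {t0..t1}" "t0 < t" and T: "T \<ge> 0"
    and below: "\<And>s. t0 \<le> s \<Longrightarrow> s \<le> t \<Longrightarrow> (T + s - t0) * grad_sq p s \<le> \<kappa> * profile_sq (u p s)"
    and touch: "(T + t - t0) * grad_sq p t = \<kappa> * profile_sq (u p t)"
  defines "x \<equiv> chart_map c p" and "G \<equiv> metric c t" and "f \<equiv> sol c t"
  shows "0 \<le> gradient_norm_sq G f x
      + (T + t - t0) * (2 * (\<Sum>k\<in>UNIV. gradient G f x $ k * pderiv_at k (laplacian G f) x)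
          + 2 * (gradient G f x \<bullet> (ricci G x *v gradient G f x)))
      - \<kappa> * profile_sq_deriv (f x) * laplacian G f x"
proof -
  define X where "X = gradient G f x"
  define L where "L = laplacian G f"
  have xU: "x \<in> chart_map c ` chart_dom c" using p by (simp add: x_def)
  have p_eq: "chart_inv c x = p" by (simp add: x_def chart_inv_chart_map c p)
  have sub: "{t0..t} \<subseteq> {t0..t1}" and subI: "{t0..t} \<subseteq> I" and pM: "p \<in> M"
    using t subset_I chart_dom_subset[OF c] p by auto
  obtain r F E where r: "r > 0" "ball x r \<subseteq> chart_map c ` chart_dom c"
    and F: "Cinf_on F (ball x r \<times> ball t r)" and "Cinf_on E (ball t r \<times> ball x r)"
    and Feq: "\<And>y s. y \<in> ball x r \<Longrightarrow> s \<in> ball t r \<Longrightarrow> s \<in> {t0..t1} \<Longrightarrow> F (y, s) = sol c s y"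
    and "\<And>y s. y \<in> ball x r \<Longrightarrow> s \<in> ball t r \<Longrightarrow> s \<in> {t0..t1} \<Longrightarrow> E (s, y) = metric c s y"
    by (rule local_extension[OF c xU t(1)]) (rule that)
  have xr: "x \<in> ball x r" and tr: "t \<in> ball t r" and tt: "t \<in> {t0..t}" using r(1) t(2) by auto
  let ?O = "ball x r \<times> ball t r"
  have O: "open ?O" by (intro open_Times open_ball)
  have axis: "(axis k 1, 0) \<in> (Basis :: ((real^'n) \<times> real) set)" for k
    by (simp add: Basis_prod_def)
  have time: "(0, 1) \<in> (Basis :: ((real^'n) \<times> real) set)"
    by (simp add: Basis_prod_def)
  have heat_L: "((\<lambda>s. sol c s y) has_real_derivative L y) (at t within {t0..t})" if y: "y \<in> ball x r" for y
  proof -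
    have yU: "y \<in> chart_map c ` chart_dom c" using y r(2) by blast
    have "((\<lambda>s. u (chart_inv c y) s) has_real_derivative laplacian_in c (g t) (\<lambda>q. u q t) (chart_inv c y))
        (at t within {t0..t1})"
      using heat t(1) c chart_inv_in_dom[OF c yU] by (auto simp: heat_solution_def)
    then show ?thesis
      using DERIV_subset[OF _ sub]
      by (simp add: laplacian_in_def chart_map_chart_inv[OF c yU] L_def G_def f_def in_chart_def o_def)
  qed
  \<comment> \<open>Established on the whole ball, because this identity is then differentiated in
    space.\<close>
  have F_time: "frechet_derivative F (at (y, t)) (0, 1) = L y" if y: "y \<in> ball x r" for y
  proof (rule DERIV_within_left_unique[OF t(2) _ heat_L[OF y]])
    have "((\<lambda>s. F (y, s)) has_real_derivative frechet_derivative F (at (y, t)) (0, 1)) (at t)"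
      by (rule has_derivative_time_slice[OF Cinf_on_differentiable[OF F]]) (use y tr in simp)
    then have "((\<lambda>s. F (y, s)) has_real_derivative frechet_derivative F (at (y, t)) (0, 1)) (at t within {t0..t})"
      by (rule has_field_derivative_at_within)
    then show "((\<lambda>s. sol c s y) has_real_derivative frechet_derivative F (at (y, t)) (0, 1)) (at t within {t0..t})"
      by (rule has_field_derivative_transform_within[OF _ r(1) tt])
        (use Feq[OF y] sub in \<open>auto simp: dist_commute\<close>)
  qed
  \<comment> \<open>The mixed derivatives of the extension commute, so the differential of u evolves
    by the differential of the Laplacian.\<close>
  have pderiv_time: "((\<lambda>s. pderiv_at k (sol c s) x) has_real_derivative pderiv_at k L x) (at t within {t0..t})" for k
  proof -
    have "pderiv_at k L x = pderiv_at k (\<lambda>y. frechet_derivative F (at (y, t)) (0, 1)) x"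
      by (rule pderiv_at_cong[OF open_ball xr]) (rule F_time[symmetric])
    also have "\<dots> = frechet_derivative (\<lambda>z. frechet_derivative F (at z) (0, 1)) (at (x, t)) (axis k 1, 0)"
      by (rule pderiv_at_space_slice[OF Cinf_on_differentiable[OF Cinf_on_frechet_derivative[OF F time]]])
        (use xr tr in simp)
    also have "\<dots> = frechet_derivative (\<lambda>z. frechet_derivative F (at z) (axis k 1, 0)) (at (x, t)) (0, 1)"
      by (rule frechet_derivative_commute[OF O _ F time axis]) (use xr tr in simp)
    finally have eq: "pderiv_at k L x = \<dots>" .
    have "((\<lambda>s. frechet_derivative F (at (x, s)) (axis k 1, 0)) has_real_derivative pderiv_at k L x) (at t)"
      unfolding eq
      by (rule has_derivative_time_slice[OF Cinf_on_differentiable[OF Cinf_on_frechet_derivative[OF F axis]]])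
        (use xr tr in simp)
    then have "((\<lambda>s. frechet_derivative F (at (x, s)) (axis k 1, 0)) has_real_derivative pderiv_at k L x)
        (at t within {t0..t})"
      by (rule has_field_derivative_at_within)
    then show ?thesis
    proof (rule has_field_derivative_transform_within[OF _ r(1) tt])
      fix s assume s: "s \<in> {t0..t}" "dist s t < r"
      then have s': "s \<in> ball t r" "s \<in> {t0..t1}" using sub by (auto simp: dist_commute)
      have "pderiv_at k (sol c s) x = pderiv_at k (\<lambda>y. F (y, s)) x"
        by (rule pderiv_at_cong[OF open_ball xr]) (rule Feq[OF _ s', symmetric])
      also have "\<dots> = frechet_derivative F (at (x, s)) (axis k 1, 0)"
        by (rule pderiv_at_space_slice[OF Cinf_on_differentiable[OF F]]) (use xr s' in simp)
      finally show "frechet_derivative F (at (x, s)) (axis k 1, 0) = pderiv_at k (sol c s) x" ..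
    qed
  qed
  obtain D where D: "((\<lambda>s. g s c p) has_vector_derivative D) (at t within I)"
    and ric: "\<And>v. v \<bullet> ((D + 2 *\<^sub>R ricci_in c (g t) p) *v v) \<ge> 0"
    using flow c p t(1) subset_I unfolding super_ricci_flow_def by blast
  have ric_eq: "ricci_in c (g t) p = ricci G x" by (simp add: ricci_in_def G_def x_def)
  have g_time: "((\<lambda>s. X \<bullet> (g s c p *v X)) has_real_derivative X \<bullet> (D *v X)) (at t within {t0..t})"
  proof -
    have "linear (\<lambda>M :: real^'n^'n. X \<bullet> (M *v X))"
      by (rule linearI) (simp_all add: matrix_vector_mult_add_rdistrib inner_add_right scaleR_matrix_vector_assoc[symmetric])
    then have "bounded_linear (\<lambda>M :: real^'n^'n. X \<bullet> (M *v X))"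
      by (simp add: linear_conv_bounded_linear)
    from bounded_linear.has_vector_derivative[OF this has_vector_derivative_within_subset[OF D subI]]
    show ?thesis by (simp add: has_real_derivative_iff_has_vector_derivative)
  qed
  \<comment> \<open>
    \<open>h\<close> bounds \<open>\<tau> |\<nabla>u|\<^sup>2 - \<kappa> \<psi>(u)\<close> at the point from below, with equality at time \<open>t\<close>; using it
    instead of the difference itself avoids differentiating the inverse metric in time.
  \<close>
  define h where "h s = (T + s - t0) * (2 * (\<Sum>k\<in>UNIV. X $ k * pderiv_at k (sol c s) x) - X \<bullet> (g s c p *v X))
    - \<kappa> * profile_sq (u p s)" for s
  have q: "(\<Sum>k\<in>UNIV. X $ k * pderiv_at k (sol c s) x) = (\<chi> k. pderiv_at k (sol c s) x) \<bullet> X" for s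
    by (simp add: inner_vec_def mult.commute)
  have g_eq: "metric c s x = g s c p" for s by (simp add: in_chart_def p_eq)
  have w: "2 * (\<Sum>k\<in>UNIV. X $ k * pderiv_at k (sol c t) x) - X \<bullet> (g t c p *v X) = gradient_norm_sq G f x"
  proof -
    have "g t c p *v X = (\<chi> k. pderiv_at k f x)"
      using matrix_inv_vector_mult(1)[OF pd_invertible[OF metric_pos(2)[OF c xU t(1)]]]
      by (simp add: X_def gradient_def G_def g_eq)
    then have "X \<bullet> (g t c p *v X) = (\<chi> k. pderiv_at k (sol c t) x) \<bullet> X"
      by (simp add: f_def inner_commute)
    moreover have "(\<chi> k. pderiv_at k (sol c t) x) \<bullet> X = gradient_norm_sq G f x"
      unfolding gradient_norm_sq_eq_inner by (simp add: X_def gradient_def f_def)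
    ultimately show ?thesis by (simp add: q)
  qed
  have h_le: "h s \<le> h t" if s: "t0 \<le> s" "s \<le> t" for s
  proof -
    have s1: "s \<in> {t0..t1}" using s sub by auto
    have "2 * (\<Sum>k\<in>UNIV. X $ k * pderiv_at k (sol c s) x) - X \<bullet> (g s c p *v X) \<le> grad_sq p s"
      unfolding grad_sq_eq[OF c p s1] gradient_norm_sq_eq_inner q x_def[symmetric]
      using two_inner_minus_quadratic_le[OF metric_pos(2,1)[OF c xU s1], of "\<chi> k. pderiv_at k (sol c s) x" X]
      by (simp add: g_eq)
    then have "(T + s - t0) * (2 * (\<Sum>k\<in>UNIV. X $ k * pderiv_at k (sol c s) x) - X \<bullet> (g s c p *v X))
        \<le> (T + s - t0) * grad_sq p s"
      using T s(1) by (intro mult_left_mono) auto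
    then have "h s \<le> 0" unfolding h_def using below[OF s] by simp
    moreover have "h t = 0"
      unfolding h_def w using touch by (simp add: grad_sq_eq[OF c p t(1)] x_def G_def f_def)
    ultimately show ?thesis by simp
  qed
  have u_eq: "u p = (\<lambda>s. sol c s x)" by (simp add: in_chart_def p_eq)
  have fx: "f x = u p t" by (simp add: f_def in_chart_def p_eq)
  have profile_time: "((\<lambda>s. profile_sq (u p s)) has_real_derivative profile_sq_deriv (u p t) * L x) (at t within {t0..t})"
    using u_range[OF pM t(1)] heat_L[OF xr]
    by (intro DERIV_chain2[OF has_derivative_profile_sq]) (simp_all add: u_eq)
  have "(h has_real_derivative
      (1 * (2 * (\<Sum>k\<in>UNIV. X $ k * pderiv_at k (sol c t) x) - X \<bullet> (g t c p *v X))
      + (2 * (\<Sum>k\<in>UNIV. X $ k * pderiv_at k L x) - X \<bullet> (D *v X)) * (T + t - t0))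
      - \<kappa> * (profile_sq_deriv (u p t) * L x)) (at t within {t0..t})"
    unfolding h_def[abs_def]
    by (intro DERIV_diff DERIV_mult DERIV_cmult DERIV_sum pderiv_time g_time profile_time)
      (auto intro!: derivative_eq_intros)
  from DERIV_within_left_nonneg[OF t(2) this h_le]
  have "0 \<le> gradient_norm_sq G f x + (2 * (\<Sum>k\<in>UNIV. X $ k * pderiv_at k L x) - X \<bullet> (D *v X)) * (T + t - t0)
      - \<kappa> * (profile_sq_deriv (u p t) * L x)"
    by (simp only: w mult_1)
  \<comment> \<open>The super Ricci flow inequality tested on X: -D(X, X) is at most 2 Ric(X,
    X).\<close>
  moreover have "(2 * (\<Sum>k\<in>UNIV. X $ k * pderiv_at k L x) - X \<bullet> (D *v X)) * (T + t - t0)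
      \<le> (2 * (\<Sum>k\<in>UNIV. X $ k * pderiv_at k L x) + 2 * (X \<bullet> (ricci G x *v X))) * (T + t - t0)"
    using ric[of X] T t(2)
    by (intro mult_right_mono)
      (simp_all add: ric_eq matrix_vector_mult_add_rdistrib inner_add_right scaleR_matrix_vector_assoc[symmetric])
  ultimately show ?thesis
    unfolding X_def[symmetric] L_def[symmetric] fx by (simp add: mult_ac)
qed

lemma strict_gradient_bound:
  assumes M: "compact M" and T: "T \<ge> 0" and \<kappa>: "\<kappa> > 1"
    and initial: "\<And>p. p \<in> M \<Longrightarrow> T * grad_sq p t0 < \<kappa> * profile_sq (u p t0)"
    and p: "p \<in> M" and t: "t \<in> {t0..t1}"
  shows "(T + t - t0) * grad_sq p t < \<kappa> * profile_sq (u p t)"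
proof (rule ccontr)
  assume contra: "\<not> ?thesis"
  define R where "R = (\<lambda>(p, t). (T + t - t0) * grad_sq p t - \<kappa> * profile_sq (u p t))"
  have profile: "continuous_on (M \<times> {t0..t1}) (\<lambda>z. profile_sq (case z of (p, t) \<Rightarrow> u p t))"
  proof (rule continuous_on_compose2[OF _ continuous_on_u])
    show "continuous_on {0<..<1} profile_sq"
      using has_derivative_profile_sq
      by (intro continuous_at_imp_continuous_on ballI) (auto intro: DERIV_isCont)
  qed (use u_range in auto)
  have "continuous_on (M \<times> {t0..t1})
      (\<lambda>z. (T + snd z - t0) * (case z of (p, t) \<Rightarrow> grad_sq p t) - \<kappa> * profile_sq (case z of (p, t) \<Rightarrow> u p t))"
    by (intro continuous_intros continuous_on_grad_sq profile)
  then have R: "continuous_on (M \<times> {t0..t1}) R"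
    by (rule continuous_on_eq) (auto simp: R_def)
  \<comment> \<open>The points where the strict bound fails. By compactness its projection to the
    time axis has a least element.\<close>
  define Z where "Z = (M \<times> {t0..t1}) \<inter> R -` {0..}"
  have "closedin (top_of_set (M \<times> {t0..t1})) Z"
    unfolding Z_def using R by (rule continuous_closedin_preimage) simp
  then have "compact Z"
    by (rule closedin_compact[OF compact_Times[OF M compact_Icc]])
  then have "compact (snd ` Z)"
    by (rule compact_continuous_image[OF continuous_on_snd[OF continuous_on_id]])
  moreover have "(p, t) \<in> Z" using contra p t by (simp add: Z_def R_def)
  ultimately obtain m where m: "m \<in> snd ` Z" "\<And>s. s \<in> snd ` Z \<Longrightarrow> m \<le> s"
    using compact_attains_inf[of "snd ` Z"] by blast
  then obtain q where qm: "(q, m) \<in> Z" by force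
  then have q: "q \<in> M" and mJ: "m \<in> {t0..t1}" and Rqm: "R (q, m) \<ge> 0" by (auto simp: Z_def)
  have neg: "R (q', s) < 0" if "q' \<in> M" "t0 \<le> s" "s < m" for q' s
  proof (rule ccontr)
    assume "\<not> R (q', s) < 0"
    then have "(q', s) \<in> Z" using that mJ by (simp add: Z_def)
    then show False using m(2)[of s] that(3) by force
  qed
  have "m \<noteq> t0" using Rqm initial[OF q] by (auto simp: R_def)
  then have m0: "t0 < m" using mJ by simp
  \<comment> \<open>Strict negativity at all earlier times passes to the limit from the left at
    every point, so the zero at q is a spatial maximum of R at time m.\<close>
  have le: "R (q', m) \<le> 0" if "q' \<in> M" for q'
  proof -
    have "continuous_on {t0..m} (\<lambda>s. R (q', s))"
      by (rule continuous_on_compose2[OF R]) (use that mJ in \<open>auto intro!: continuous_intros\<close>)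
    then have "((\<lambda>s. R (q', s)) \<longlongrightarrow> R (q', m)) (at_left m)"
      using m0 by (simp add: continuous_on_def at_within_Icc_at_left[symmetric])
    moreover have "\<forall>\<^sub>F s in at_left m. R (q', s) \<le> 0"
      using eventually_at_left_real[OF m0] by eventually_elim (use neg[OF that] in \<open>auto intro: less_imp_le\<close>)
    ultimately show ?thesis by (rule tendsto_upperbound) simp
  qed
  obtain c where c: "c \<in> A" "q \<in> chart_dom c" using atlas q by (auto simp: smooth_atlas_def)
  define x where "x = chart_map c q"
  have xU: "x \<in> chart_map c ` chart_dom c" using c by (simp add: x_def)
  obtain r where r: "r > 0" "ball x r \<subseteq> chart_map c ` chart_dom c"
    "Cinf_on (sol c m) (ball x r)" "local_metric (metric c m) (ball x r)"
    by (rule local_smooth[OF c(1) xU mJ]) (rule that)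
  interpret L: local_metric "metric c m" "ball x r" by (rule r(4))
  have range: "0 < sol c m y" "sol c m y < 1" if "y \<in> ball x r" for y
    using sol_range[OF c(1) _ mJ] that r(2) by blast+
  have touch: "(T + m - t0) * grad_sq q m = \<kappa> * profile_sq (u q m)"
    using Rqm le[OF q] by (simp add: R_def)
  have below: "(T + s - t0) * grad_sq q s \<le> \<kappa> * profile_sq (u q s)" if "t0 \<le> s" "s \<le> m" for s
    using neg[OF q that(1)] le[OF q] that(2) by (cases "s = m") (auto simp: R_def)
  have x: "x \<in> ball x r" using r(1) by simp
  have sol_x: "sol c m x = u q m" by (simp add: x_def in_chart_chart_map c)
  show False
  proof (rule L.no_first_touching[OF x r(3), of "T + m - t0" \<kappa> profile_sq profile_sq_deriv])
    show "T + m - t0 > 0" using T m0 by simp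
    show "(profile_sq has_real_derivative profile_sq_deriv (sol c m y)) (at (sol c m y))"
      if "y \<in> ball x r" for y
      using range[OF that] by (rule has_derivative_profile_sq)
    show "(profile_sq_deriv has_real_derivative ((Phi_quantile (sol c m x))\<^sup>2 / 2 - 1)) (at (sol c m x))"
      using range[OF x] by (rule has_derivative_profile_sq_deriv)
    show "(T + m - t0) * gradient_norm_sq (metric c m) (sol c m) y \<le> \<kappa> * profile_sq (sol c m y)"
      if "y \<in> ball x r" for y
    proof -
      have y: "y \<in> chart_map c ` chart_dom c" using that r(2) by blast
      then have yM: "chart_inv c y \<in> M" using chart_inv_in_dom chart_dom_subset c(1) by blast
      show ?thesis
        using le[OF yM] grad_sq_eq[OF c(1) chart_inv_in_dom[OF c(1) y] mJ] chart_map_chart_inv[OF c(1) y]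
        by (simp add: R_def in_chart_def)
    qed
    show "(T + m - t0) * gradient_norm_sq (metric c m) (sol c m) x = \<kappa> * profile_sq (sol c m x)"
      using touch grad_sq_eq[OF c mJ] by (simp add: sol_x x_def[symmetric])
    show "0 \<le> gradient_norm_sq (metric c m) (sol c m) x
      + (T + m - t0) * (2 * (\<Sum>k\<in>UNIV. gradient (metric c m) (sol c m) x $ k
              * pderiv_at k (laplacian (metric c m) (sol c m)) x)
          + 2 * (gradient (metric c m) (sol c m) x \<bullet> (ricci (metric c m) x *v gradient (metric c m) (sol c m) x)))
      - \<kappa> * profile_sq_deriv (sol c m x) * laplacian (metric c m) (sol c m) x"
      unfolding x_def by (rule touching_time_inequality[OF c mJ m0 T below touch])
  qed (use \<kappa> profile_sq_pos profile_sq_deriv_square in auto)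
qed

text \<open>The chain rule moves the singular dependence on \<tau> out of the gradient; the
  right-hand side remains meaningful for \<tau> = 0.\<close>

lemma grad_norm_le_one_iff:
  assumes c: "c \<in> A" and p: "p \<in> chart_dom c" and t: "t \<in> {t0..t1}" and \<tau>: "\<tau> > 0"
  shows "grad_norm_in c (g t) (\<lambda>q. Phi_inv \<tau> (u q t)) p \<le> 1 \<longleftrightarrow> \<tau> * grad_sq p t \<le> profile_sq (u p t)"
proof -
  define x where "x = chart_map c p"
  have xU: "x \<in> chart_map c ` chart_dom c" using p by (simp add: x_def)
  obtain r where r: "r > 0" "ball x r \<subseteq> chart_map c ` chart_dom c"
    "Cinf_on (sol c t) (ball x r)" "local_metric (metric c t) (ball x r)"
    by (rule local_smooth[OF c xU t]) (rule that)
  have x: "x \<in> ball x r" using r(1) by simp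
  have range: "0 < sol c t y" "sol c t y < 1" if "y \<in> ball x r" for y
    using sol_range[OF c _ t] that r(2) by blast+
  \<comment> \<open>The derivative of \<open>Phi_inv \<tau>\<close> at the value of u; its square is
    \<tau> / psi(u).\<close>
  define d where "d = sqrt \<tau> * inverse (Phi_deriv (Phi_quantile (sol c t x)))"
  have "gradient_norm_sq (metric c t) (in_chart c (\<lambda>q. Phi_inv \<tau> (u q t))) x
      = gradient_norm_sq (metric c t) (\<lambda>y. sqrt \<tau> * Phi_quantile (sol c t y)) x"
  proof -
    have "pderiv_at i (in_chart c (\<lambda>q. Phi_inv \<tau> (u q t))) x
        = pderiv_at i (\<lambda>y. sqrt \<tau> * Phi_quantile (sol c t y)) x" for i
      by (rule pderiv_at_cong[OF open_ball x])
        (use range Phi_inv_eq[OF \<tau>] in \<open>simp add: in_chart_def\<close>)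
    then show ?thesis by (simp add: gradient_norm_sq_eq_inner)
  qed
  also have "\<dots> = d\<^sup>2 * gradient_norm_sq (metric c t) (sol c t) x"
    unfolding d_def
    by (rule gradient_norm_sq_chain[OF Cinf_on_differentiable[OF r(3) x] DERIV_cmult])
      (use range[OF x] has_derivative_Phi_quantile in blast)
  also have "\<dots> = \<tau> * grad_sq p t / profile_sq (u p t)"
    using \<tau> by (simp add: d_def grad_sq_eq[OF c p t] x_def profile_sq_def in_chart_chart_map c p
        power_mult_distrib power_inverse divide_inverse)
  finally have "grad_norm_in c (g t) (\<lambda>q. Phi_inv \<tau> (u q t)) p = sqrt (\<tau> * grad_sq p t / profile_sq (u p t))"
    using grad_norm_in_eq[OF riemannian[OF t] c p] by (simp add: x_def)
  then show ?thesis
    using profile_sq_pos[of "u p t"] by (simp add: divide_le_eq)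
qed

end

lemma le_of_le_mult_gt_one:
  fixes a b :: real
  assumes "\<And>k. 1 < k \<Longrightarrow> a \<le> k * b"
  shows "a \<le> b"
proof (rule tendsto_lowerbound[of "\<lambda>k. k * b" b "at_right 1" a])
  show "((\<lambda>k. k * b) \<longlongrightarrow> b) (at_right 1)"
    by (auto intro!: tendsto_eq_intros)
  show "\<forall>\<^sub>F k in at_right 1. a \<le> k * b"
    using eventually_at_right_less[of "1::real"] by eventually_elim (rule assms)
qed simp

theorem theorem4p1:
  fixes M :: "'a::t2_space set"
    and A :: "('a, 'n::finite) chart set"
    and I :: "real set"
    and g :: "real \<Rightarrow> ('a, 'n) tensor2"
    and u :: "'a \<Rightarrow> real \<Rightarrow> real"
    and t0 t1 T :: real
  assumes "compact_manifold M A"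
    and "super_ricci_flow A I g"
    and "t0 \<le> t1" and "{t0..t1} \<subseteq> I"
    and "heat_solution A {t0..t1} g u"
    and "T \<ge> 0"
    and "\<And>p t. p \<in> M \<Longrightarrow> t \<in> {t0..t1} \<Longrightarrow> u p t \<in> {0<..<1}"
    and "T > 0 \<Longrightarrow> \<forall>c\<in>A. \<forall>p\<in>chart_dom c.
           grad_norm_in c (g t0) (\<lambda>q. Phi_inv T (u q t0)) p \<le> 1"
  shows "\<forall>t\<in>{t0..t1}. T + t - t0 > 0 \<longrightarrow>
           (\<forall>c\<in>A. \<forall>p\<in>chart_dom c.
              grad_norm_in c (g t) (\<lambda>q. Phi_inv (T + t - t0) (u q t)) p \<le> 1)"
proof (intro ballI impI)
  interpret heat_on_super_ricci_flow M A I g u t0 t1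
    using assms by unfold_locales (auto simp: compact_manifold_def)
  fix t c p assume t: "t \<in> {t0..t1}" and \<tau>: "T + t - t0 > 0" and c: "c \<in> A" and p: "p \<in> chart_dom c"
  have M: "compact M" using assms(1) by (simp add: compact_manifold_def)
  have pM: "p \<in> M" using chart_dom_subset[OF c] p by blast
  have t0: "t0 \<in> {t0..t1}" using assms(3) by simp
  have initial: "T * grad_sq q t0 \<le> profile_sq (u q t0)" if q: "q \<in> M" for q
  proof (cases "T = 0")
    case True
    then show ?thesis using less_imp_le[OF profile_sq_pos] by simp
  next
    case False
    then have "T > 0" using assms(6) by simp
    moreover obtain d where "d \<in> A" "q \<in> chart_dom d" using atlas q by (auto simp: smooth_atlas_def)
    ultimately show ?thesis using assms(8) grad_norm_le_one_iff[OF _ _ t0] by blast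
  qed
  have "(T + t - t0) * grad_sq p t \<le> profile_sq (u p t)"
  proof (rule le_of_le_mult_gt_one)
    fix \<kappa> :: real assume \<kappa>: "1 < \<kappa>"
    \<comment> \<open>Positivity of the profile makes the weak initial bound strict after
      multiplication by \<kappa>.\<close>
    have "T * grad_sq q t0 < \<kappa> * profile_sq (u q t0)" if "q \<in> M" for q
      using initial[OF that] mult_strict_right_mono[OF \<kappa> profile_sq_pos[of "u q t0"]] by simp
    from strict_gradient_bound[OF M assms(6) \<kappa> this pM t]
    show "(T + t - t0) * grad_sq p t \<le> \<kappa> * profile_sq (u p t)" by simp
  qed
  then show "grad_norm_in c (g t) (\<lambda>q. Phi_inv (T + t - t0) (u q t)) p \<le> 1"
    using grad_norm_le_one_iff[OF c p t \<tau>] by simp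
qed

end
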